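(* Let $\lambda,\mu,\alpha,\beta>0$ satisfy $\lambda<\frac{\beta}{\alpha+\beta}\mu$, and let $\pi$ be the stationary distribution of Model 2 with $p=1$ (the tandem of a reliable server 2 followed by an unreliable server 1). Then for every $y\in\mathbb N$, as $k\to\infty$, $$\pi(k,y,U)\sim C^{(2)}(U)\left(\frac\lambda\mu\right)^y\gamma_1^k,\qquad \pi(k,y,D)\sim C^{(2)}(D)\left(\frac\lambda\mu\right)^y\gamma_1^k,$$ where $$C^{(2)}(U)=\frac{\eta^{(2)}}{\tilde d^{(2)}}\cdot\frac1G\cdot\frac{\lambda+\beta-\mu-\alpha+\sqrt{s_1}}{2}\cdot B\neq0,\qquad C^{(2)}(D)=\frac{\eta^{(2)}}{\tilde d^{(2)}}\cdot\frac{\alpha}{G}\cdot B\neq0,$$ $$B=1-\frac{\lambda+\beta+\mu+\alpha-\sqrt{s_1}}{2\mu}.$$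
   Context: Notation: $n_k\sim m_k$ means $n_k/m_k\to1$ as $k\to\infty$; $\mathbb N=\{0,1,2,\dots\}$; $U$ = Up, $D$ = Down. Model 2 with $p=1$: the continuous-time Markov chain on $\mathbb N\times\mathbb N\times\{U,D\}$ with states $(x,y,\sigma)$, where $x$ is the number of customers at the unreliable server 1, $y$ the number at the reliable server 2, and $\sigma$ the status of server 1, with transition intensities: $(x,y,\sigma)\to(x,y+1,\sigma)$ at rate $\lambda$; $(x,y,\sigma)\to(x+1,y-1,\sigma)$ at rate $\mu$ for $y\ge1$ and both values of $\sigma$; $(x,y,U)\to(x-1,y,U)$ at rate $\mu$ for $x\ge1$; $(x,y,U)\to(x,y,D)$ at rate $\alpha$; $(x,y,D)\to(x,y,U)$ at rate $\beta$. Under $\lambda<\frac{\beta}{\alpha+\beta}\mu$ it has a unique stationary distribution $\pi$. Constants: $$s_1=(\mu-\lambda-\beta-\alpha)^2+4\alpha\mu,\qquad \gamma_1=\frac{2\lambda}{\lambda+\beta+\mu+\alpha-\sqrt{s_1}}\in(0,1),$$ $$G=\frac{\lambda+\beta-\mu-\alpha+\sqrt{s_1}}{2}+\frac{2\alpha\beta}{\lambda+\beta-\mu-\alpha+\sqrt{s_1}}.$$ Fix a uniformization constant $C\ge\lambda+2\mu+\alpha+\beta$ and put $$\tilde d^{(2)}=\frac1C\left(\frac{\lambda+\mu+\beta+\alpha-\sqrt{s_1}}{2}-\frac{2\lambda\mu(\lambda+\beta-\mu-\alpha+\sqrt{s_1})^2}{(\lambda+\beta+\mu+\alpha-\sqrt{s_1})\left(4\alpha\beta+(\lambda+\beta-\mu-\alpha+\sqrt{s_1})^2\right)}\right).$$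 Definition of $\eta^{(2)}$: let $\mathbf K^\infty$ be the kernel on $\mathbb Z\times\mathbb N\times\{U,D\}$ (the free process), shift invariant in the first coordinate, with, for $m\in\mathbb Z$, $y\in\mathbb N$: $\mathbf K^\infty((m,y,\sigma),(m,y+1,\sigma))=\lambda/C$; $\mathbf K^\infty((m,y,\sigma),(m+1,y-1,\sigma))=\mu/C$ if $y\ge1$; $\mathbf K^\infty((m,y,U),(m-1,y,U))=\mu/C$; $\mathbf K^\infty((m,y,U),(m,y,D))=\alpha/C$; $\mathbf K^\infty((m,y,D),(m,y,U))=\beta/C$; and the remaining probability on staying put. Let $h(x,y,U)=\gamma_1^{-(x+y)}$ and $h(x,y,D)=\gamma_1^{-(x+y)}\,\frac{2\beta}{\lambda+\beta-\mu-\alpha+\sqrt{s_1}}$, and let the twisted free process be the discrete-time Markov chain with transition kernel $\mathcal K(z,z')=\mathbf K^\infty(z,z')h(z')/h(z)$. Then $$\eta^{(2)}=\sum_{y\in\mathbb N}\ \sum_{\sigma\in\{U,D\}}\pi(0,y,\sigma)\,h(0,y,\sigma)\,\mathcal H(0,y,\sigma),$$ where $\mathcal H(0,y,\sigma)$ is the probability that the twisted free process started at $(0,y,\sigma)$ has strictly positive first coordinate at all times $n\ge1$. *)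

theory Defs
  imports "HOL-Probability.Probability" "HOL-Library.Landau_Symbols"
begin

section \<open>Markov chains in continuous and in discrete time\<close>

text \<open>
  A continuous-time chain is given by its off-diagonal transition intensities \<open>q\<close>; the diagonal
  of the generator is minus the total exit rate. Stationarity is \<open>\<pi> Q = 0\<close>, the usual definition
  for chains with bounded intensities (all chains below).
\<close>

definition generator :: "('a \<Rightarrow> 'a \<Rightarrow> real) \<Rightarrow> 'a \<Rightarrow> 'a \<Rightarrow> real" where
  "generator q z z' = (if z' = z then - (\<Sum>\<^sub>\<infinity>w\<in>-{z}. q z w) else q z z')"

definition stationary_distribution :: "('a \<Rightarrow> 'a \<Rightarrow> real) \<Rightarrow> 'a pmf \<Rightarrow> bool" where
  "stationary_distribution q \<pi> \<longleftrightarrow> (\<forall>z'. (\<Sum>\<^sub>\<infinity>z. pmf \<pi> z * generator q z z') = 0)"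

text \<open>
  The law, on trajectories \<open>nat \<Rightarrow> 'a\<close>, of the discrete-time chain with transition kernel \<open>K\<close>
  started at \<open>z\<close>, obtained from the Ionescu-Tulcea theorem. The conditional law of the state at
  time \<open>n\<close> given the past \<open>\<omega>\<close> is \<open>chain_step K z n \<omega>\<close>.
\<close>

definition chain_step :: "('a \<Rightarrow> 'a pmf) \<Rightarrow> 'a \<Rightarrow> nat \<Rightarrow> (nat \<Rightarrow> 'a) \<Rightarrow> 'a measure" where
  "chain_step K z n \<omega> = measure_pmf (if n = 0 then return_pmf z else K (\<omega> (n - 1)))"

definition chain_law :: "('a \<Rightarrow> 'a pmf) \<Rightarrow> 'a \<Rightarrow> (nat \<Rightarrow> 'a) measure" where
  "chain_law K z =
     projective_family.lim UNIV
       (Ionescu_Tulcea.CI (chain_step K z) (\<lambda>_. count_space UNIV)) (\<lambda>_. count_space UNIV)"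

lemma Ionescu_Tulcea_chain_step: "Ionescu_Tulcea (chain_step K z) (\<lambda>_. count_space UNIV)"
proof (rule Ionescu_Tulcea.intro)
  fix i :: nat
  show "chain_step K z i \<in> measurable (PiM {0..<i} (\<lambda>_. count_space UNIV)) (subprob_algebra (count_space UNIV))"
  proof (cases i)
    case 0
    have "chain_step K z 0 = (\<lambda>_. measure_pmf (return_pmf z))"
      by (simp add: chain_step_def fun_eq_iff)
    then show ?thesis
      using 0 by (simp add: measurable_const space_subprob_algebra measure_pmf.subprob_space_axioms)
  next
    case (Suc n)
    have "(\<lambda>\<omega>. measure_pmf (K (\<omega> n))) \<in> measurable (PiM {0..<Suc n} (\<lambda>_. count_space UNIV)) (subprob_algebra (count_space UNIV))"
      by (rule measurable_compose[OF measurable_component_singleton[where i=n]])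
         (auto simp: space_subprob_algebra measure_pmf.subprob_space_axioms)
    moreover have "chain_step K z (Suc n) = (\<lambda>\<omega>. measure_pmf (K (\<omega> n)))"
      by (simp add: chain_step_def fun_eq_iff)
    ultimately show ?thesis using Suc by simp
  qed
next
  show "prob_space (chain_step K z i x)" if "x \<in> space (PiM {0..<i} (\<lambda>_. count_space UNIV))" for i x
    by (simp add: chain_step_def measure_pmf.prob_space_axioms)
qed

lemma emeasure_chain_law_cylinder:
  "emeasure (chain_law K z) {\<omega>. \<forall>i\<le>n. \<omega> i = a i} =
     (if a 0 = z then ennreal (\<Prod>i<n. pmf (K (a i)) (a (Suc i))) else 0)"
proof -
  let ?M = "\<lambda>_::nat. count_space (UNIV :: 'a set)"
  interpret IT: Ionescu_Tulcea "chain_step K z" ?M by (rule Ionescu_Tulcea_chain_step)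
  define S where "S n = PiE {0..<n} (\<lambda>i. {a i})" for n :: nat
  have S_sets[measurable]: "S n \<in> sets (PiM {0..<n} ?M)" for n
    unfolding S_def by (intro sets_PiM_I_finite) auto
  have S_eq: "S n = {restrict a {0..<n}}" for n
    unfolding S_def by (auto simp: PiE_iff extensional_def restrict_def fun_eq_iff)
  have undef: "(\<lambda>_. undefined) \<in> space (PiM {0..<0} ?M)"
    by (simp add: space_PiM)
  have C: "emeasure (IT.C 0 (Suc n) (\<lambda>_. undefined)) (S (Suc n)) =
     (if a 0 = z then ennreal (\<Prod>i<n. pmf (K (a i)) (a (Suc i))) else 0)" for n
  proof -
    have step: "emeasure (IT.C 0 (Suc n) (\<lambda>_. undefined)) (S (Suc n)) =
      emeasure (chain_step K z n (restrict a {0..<n})) {a n} * emeasure (IT.C 0 n (\<lambda>_. undefined)) (S n)" for n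
    proof -
      have "emeasure (IT.C 0 (Suc n) (\<lambda>_. undefined)) (S (Suc n)) =
         (\<integral>\<^sup>+ x. emeasure (IT.eP n x) (S (Suc n)) \<partial>IT.C 0 n (\<lambda>_. undefined))"
        using IT.measurable_eP[of n] undef
        by (simp add: emeasure_bind[where N="PiM {0..<Suc n} ?M"] IT.space_C
              measurable_cong_sets[OF IT.sets_C[OF undef] refl])
      also have "\<dots> = (\<integral>\<^sup>+ x. emeasure (chain_step K z n (restrict a {0..<n})) {a n} * indicator (S n) x \<partial>IT.C 0 n (\<lambda>_. undefined))"
      proof (rule nn_integral_cong)
        fix x assume "x \<in> space (IT.C 0 n (\<lambda>_. undefined))"
        then have x: "x \<in> space (PiM {0..<n} ?M)"
          using IT.space_C[OF undef, of n] by simp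
        then have xe: "x \<in> extensional {0..<n}" by (simp add: space_PiM PiE_def)
        have "x(n := y) \<in> S (Suc n) \<longleftrightarrow> x \<in> S n \<and> y = a n" for y
          using xe by (auto simp: S_def PiE_iff extensional_def less_Suc_eq)
        then have "(\<lambda>y. x(n := y)) -` S (Suc n) \<inter> UNIV = (if x \<in> S n then {a n} else {})"
          by auto
        then have "emeasure (IT.eP n x) (S (Suc n)) =
            emeasure (chain_step K z n x) (if x \<in> S n then {a n} else {})"
          by (subst IT.emeasure_eP[OF x S_sets]) simp
        then show "emeasure (IT.eP n x) (S (Suc n)) =
            emeasure (chain_step K z n (restrict a {0..<n})) {a n} * indicator (S n) x"
          by (auto simp: S_eq)
      qed
      also have "\<dots> = emeasure (chain_step K z n (restrict a {0..<n})) {a n} * emeasure (IT.C 0 n (\<lambda>_. undefined)) (S n)"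
        using IT.sets_C[OF undef, of n] by (intro nn_integral_cmult_indicator) simp
      finally show ?thesis .
    qed
    show ?thesis
    proof (induction n)
      case 0
      have S0: "S 0 = {\<lambda>_. undefined}" by (simp add: S_eq restrict_def)
      have "S 0 \<in> sets (PiM {0..<0} ?M)" by (rule S_sets)
      then have "emeasure (IT.C 0 0 (\<lambda>_. undefined)) (S 0) = 1"
        by (simp add: S0)
      then have "emeasure (IT.C 0 (Suc 0) (\<lambda>_. undefined)) (S (Suc 0)) =
          emeasure (chain_step K z 0 (restrict a {0..<0})) {a 0}"
        by (subst step) simp
      also have "\<dots> = (if a 0 = z then ennreal (\<Prod>i<0. pmf (K (a i)) (a (Suc i))) else 0)"
        by (simp add: chain_step_def emeasure_pmf_single indicator_def)
      finally show ?case .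
    next
      case (Suc n)
      have *: "emeasure (chain_step K z (Suc n) (restrict a {0..<Suc n})) {a (Suc n)} =
          ennreal (pmf (K (a n)) (a (Suc n)))"
        by (simp add: chain_step_def emeasure_pmf_single)
      show ?case
        unfolding step[of "Suc n"] Suc.IH *
        by (simp add: ennreal_mult'' prod_nonneg mult.commute)
    qed
  qed
  have "{\<omega>. \<forall>i\<le>n. \<omega> i = a i} = prod_emb UNIV ?M {0..<Suc n} (S (Suc n))"
    by (auto simp: S_def prod_emb_def PiE_iff space_PiM less_Suc_eq_le)
  then have "emeasure (chain_law K z) {\<omega>. \<forall>i\<le>n. \<omega> i = a i} =
      emeasure (IT.CI {0..<Suc n}) (S (Suc n))"
    unfolding chain_law_def by (simp only: IT.lim[OF _ S_sets] finite_atLeastLessThan)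
  also have "\<dots> = emeasure (IT.C 0 (Suc n) (\<lambda>_. undefined)) (prod_emb {0..<Suc n} ?M {0..<Suc n} (S (Suc n)))"
    by (rule IT.emeasure_CI) auto
  also have "prod_emb {0..<Suc n} ?M {0..<Suc n} (S (Suc n)) = S (Suc n)"
    by (rule prod_emb_id) (auto simp: S_def PiE_iff)
  finally show ?thesis using C by simp
qed


section \<open>The tandem queue\<close>

datatype status = Up | Down

text \<open>\<open>(x, y, s)\<close>: customers at the unreliable server 1, at the reliable server 2, status of server 1.\<close>
type_synonym state = "nat \<times> nat \<times> status"

type_synonym free_state = "int \<times> nat \<times> status"

fun rate :: "real \<Rightarrow> real \<Rightarrow> real \<Rightarrow> real \<Rightarrow> state \<Rightarrow> state \<Rightarrow> real" where
  "rate lam \<mu> \<alpha> \<beta> (x, y, s) (x', y', s') =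
     (if x' = x \<and> y' = y + 1 \<and> s' = s then lam
      else if y \<ge> 1 \<and> x' = x + 1 \<and> y' = y - 1 \<and> s' = s then \<mu>
      else if x \<ge> 1 \<and> x' = x - 1 \<and> y' = y \<and> s = Up \<and> s' = Up then \<mu>
      else if x' = x \<and> y' = y \<and> s = Up \<and> s' = Down then \<alpha>
      else if x' = x \<and> y' = y \<and> s = Down \<and> s' = Up then \<beta>
      else 0)"

definition s1 :: "real \<Rightarrow> real \<Rightarrow> real \<Rightarrow> real \<Rightarrow> real" where
  "s1 lam \<mu> \<alpha> \<beta> = (\<mu> - lam - \<beta> - \<alpha>)\<^sup>2 + 4 * \<alpha> * \<mu>"

definition gamma1 :: "real \<Rightarrow> real \<Rightarrow> real \<Rightarrow> real \<Rightarrow> real" where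
  "gamma1 lam \<mu> \<alpha> \<beta> = 2 * lam / (lam + \<beta> + \<mu> + \<alpha> - sqrt (s1 lam \<mu> \<alpha> \<beta>))"

definition G_const :: "real \<Rightarrow> real \<Rightarrow> real \<Rightarrow> real \<Rightarrow> real" where
  "G_const lam \<mu> \<alpha> \<beta> =
     (lam + \<beta> - \<mu> - \<alpha> + sqrt (s1 lam \<mu> \<alpha> \<beta>)) / 2
     + 2 * \<alpha> * \<beta> / (lam + \<beta> - \<mu> - \<alpha> + sqrt (s1 lam \<mu> \<alpha> \<beta>))"

definition B_const :: "real \<Rightarrow> real \<Rightarrow> real \<Rightarrow> real \<Rightarrow> real" where
  "B_const lam \<mu> \<alpha> \<beta> =
     1 - (lam + \<beta> + \<mu> + \<alpha> - sqrt (s1 lam \<mu> \<alpha> \<beta>)) / (2 * \<mu>)"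

definition d2_tilde :: "real \<Rightarrow> real \<Rightarrow> real \<Rightarrow> real \<Rightarrow> real \<Rightarrow> real" where
  "d2_tilde C lam \<mu> \<alpha> \<beta> = 1 / C *
     ((lam + \<mu> + \<beta> + \<alpha> - sqrt (s1 lam \<mu> \<alpha> \<beta>)) / 2
      - 2 * lam * \<mu> * (lam + \<beta> - \<mu> - \<alpha> + sqrt (s1 lam \<mu> \<alpha> \<beta>))\<^sup>2
        / ((lam + \<beta> + \<mu> + \<alpha> - sqrt (s1 lam \<mu> \<alpha> \<beta>))
           * (4 * \<alpha> * \<beta> + (lam + \<beta> - \<mu> - \<alpha> + sqrt (s1 lam \<mu> \<alpha> \<beta>))\<^sup>2)))"


section \<open>The free process and its twist\<close>

fun free_jump :: "real \<Rightarrow> real \<Rightarrow> real \<Rightarrow> real \<Rightarrow> real \<Rightarrow> free_state \<Rightarrow> free_state \<Rightarrow> real" where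
  "free_jump C lam \<mu> \<alpha> \<beta> (m, y, s) (m', y', s') =
     (if m' = m \<and> y' = y + 1 \<and> s' = s then lam / C
      else if y \<ge> 1 \<and> m' = m + 1 \<and> y' = y - 1 \<and> s' = s then \<mu> / C
      else if m' = m - 1 \<and> y' = y \<and> s = Up \<and> s' = Up then \<mu> / C
      else if m' = m \<and> y' = y \<and> s = Up \<and> s' = Down then \<alpha> / C
      else if m' = m \<and> y' = y \<and> s = Down \<and> s' = Up then \<beta> / C
      else 0)"

definition free_kernel :: "real \<Rightarrow> real \<Rightarrow> real \<Rightarrow> real \<Rightarrow> real \<Rightarrow> free_state \<Rightarrow> free_state \<Rightarrow> real" where
  "free_kernel C lam \<mu> \<alpha> \<beta> z z' =
     (if z' = z then 1 - (\<Sum>\<^sub>\<infinity>w\<in>-{z}. free_jump C lam \<mu> \<alpha> \<beta> z w)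
      else free_jump C lam \<mu> \<alpha> \<beta> z z')"

fun twist_h :: "real \<Rightarrow> real \<Rightarrow> real \<Rightarrow> real \<Rightarrow> free_state \<Rightarrow> real" where
  "twist_h lam \<mu> \<alpha> \<beta> (x, y, Up) = gamma1 lam \<mu> \<alpha> \<beta> powi (- (x + int y))"
| "twist_h lam \<mu> \<alpha> \<beta> (x, y, Down) = gamma1 lam \<mu> \<alpha> \<beta> powi (- (x + int y))
     * (2 * \<beta> / (lam + \<beta> - \<mu> - \<alpha> + sqrt (s1 lam \<mu> \<alpha> \<beta>)))"

text \<open>
  \<open>embed_pmf\<close> needs a nonnegative function of total mass 1; this holds for all positive intensities
  and every uniformization constant, see \<open>pmf_twisted_kernel\<close>.
\<close>
definition twisted_kernel :: "real \<Rightarrow> real \<Rightarrow> real \<Rightarrow> real \<Rightarrow> real \<Rightarrow> free_state \<Rightarrow> free_state pmf" where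
  "twisted_kernel C lam \<mu> \<alpha> \<beta> z = embed_pmf
     (\<lambda>z'. free_kernel C lam \<mu> \<alpha> \<beta> z z' * twist_h lam \<mu> \<alpha> \<beta> z' / twist_h lam \<mu> \<alpha> \<beta> z)"

definition H_twisted :: "real \<Rightarrow> real \<Rightarrow> real \<Rightarrow> real \<Rightarrow> real \<Rightarrow> free_state \<Rightarrow> real" where
  "H_twisted C lam \<mu> \<alpha> \<beta> z =
     measure (chain_law (twisted_kernel C lam \<mu> \<alpha> \<beta>) z) {\<omega>. \<forall>n\<ge>1. fst (\<omega> n) > 0}"

definition eta2 :: "real \<Rightarrow> real \<Rightarrow> real \<Rightarrow> real \<Rightarrow> real \<Rightarrow> state pmf \<Rightarrow> real" where
  "eta2 C lam \<mu> \<alpha> \<beta> \<pi> =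
     (\<Sum>\<^sub>\<infinity>y. \<Sum>s\<in>{Up, Down}.
        pmf \<pi> (0, y, s) * twist_h lam \<mu> \<alpha> \<beta> (0, y, s) * H_twisted C lam \<mu> \<alpha> \<beta> (0, y, s))"

fun C2 :: "real \<Rightarrow> real \<Rightarrow> real \<Rightarrow> real \<Rightarrow> real \<Rightarrow> state pmf \<Rightarrow> status \<Rightarrow> real" where
  "C2 C lam \<mu> \<alpha> \<beta> \<pi> Up =
     eta2 C lam \<mu> \<alpha> \<beta> \<pi> / d2_tilde C lam \<mu> \<alpha> \<beta> * (1 / G_const lam \<mu> \<alpha> \<beta>)
     * ((lam + \<beta> - \<mu> - \<alpha> + sqrt (s1 lam \<mu> \<alpha> \<beta>)) / 2) * B_const lam \<mu> \<alpha> \<beta>"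
| "C2 C lam \<mu> \<alpha> \<beta> \<pi> Down =
     eta2 C lam \<mu> \<alpha> \<beta> \<pi> / d2_tilde C lam \<mu> \<alpha> \<beta> * (\<alpha> / G_const lam \<mu> \<alpha> \<beta>) * B_const lam \<mu> \<alpha> \<beta>"

context
  fixes C lam \<mu> \<alpha> \<beta> :: real
  assumes pos: "lam > 0" "\<mu> > 0" "\<alpha> > 0" "\<beta> > 0" and C: "C \<ge> lam + 2 * \<mu> + \<alpha> + \<beta>"
begin

lemma sqrt_s1_bounds:
  "lam + \<beta> - \<mu> - \<alpha> + sqrt (s1 lam \<mu> \<alpha> \<beta>) > 0"
  "lam + \<beta> + \<mu> + \<alpha> - sqrt (s1 lam \<mu> \<alpha> \<beta>) > 0"
proof -
  have "\<bar>\<mu> + \<alpha> - lam - \<beta>\<bar> < sqrt (s1 lam \<mu> \<alpha> \<beta>)"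
  proof (rule real_less_rsqrt)
    have "s1 lam \<mu> \<alpha> \<beta> = (\<mu> + \<alpha> - lam - \<beta>)\<^sup>2 + 4 * \<alpha> * (lam + \<beta>)"
      by (simp add: s1_def power2_eq_square algebra_simps)
    then show "\<bar>\<mu> + \<alpha> - lam - \<beta>\<bar>\<^sup>2 < s1 lam \<mu> \<alpha> \<beta>"
      using pos by (simp add: add_pos_pos)
  qed
  then show "lam + \<beta> - \<mu> - \<alpha> + sqrt (s1 lam \<mu> \<alpha> \<beta>) > 0" by linarith
  have "sqrt (s1 lam \<mu> \<alpha> \<beta>) < lam + \<beta> + \<mu> + \<alpha>"
  proof (rule real_less_lsqrt)
    have "(lam + \<beta> + \<mu> + \<alpha>)\<^sup>2 = s1 lam \<mu> \<alpha> \<beta> + 4 * \<mu> * (lam + \<beta>)"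
      by (simp add: s1_def power2_eq_square algebra_simps)
    moreover have "4 * \<mu> * (lam + \<beta>) > 0" using pos by simp
    ultimately show "s1 lam \<mu> \<alpha> \<beta> < (lam + \<beta> + \<mu> + \<alpha>)\<^sup>2" by linarith
  qed (use pos in auto)
  then show "lam + \<beta> + \<mu> + \<alpha> - sqrt (s1 lam \<mu> \<alpha> \<beta>) > 0" by linarith
qed

lemma gamma1_pos: "gamma1 lam \<mu> \<alpha> \<beta> > 0"
  using pos sqrt_s1_bounds(2) by (simp add: gamma1_def)

lemma twist_h_pos: "twist_h lam \<mu> \<alpha> \<beta> z > 0"
  using gamma1_pos sqrt_s1_bounds(1) pos
  by (cases "(lam, \<mu>, \<alpha>, \<beta>, z)" rule: twist_h.cases) (auto intro!: mult_pos_pos divide_pos_pos)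

lemma twist_h_harmonic:
  defines "g \<equiv> gamma1 lam \<mu> \<alpha> \<beta>"
    and "c \<equiv> 2 * \<beta> / (lam + \<beta> - \<mu> - \<alpha> + sqrt (s1 lam \<mu> \<alpha> \<beta>))"
  shows "lam / g + \<mu> * g + \<alpha> * c = lam + \<mu> + \<alpha>" "lam / g + \<beta> / c = lam + \<beta>"
proof -
  define t where "t = (lam + \<beta> - \<mu> - \<alpha> + sqrt (s1 lam \<mu> \<alpha> \<beta>)) / 2"
  define r where "r = (lam + \<beta> + \<mu> + \<alpha> - sqrt (s1 lam \<mu> \<alpha> \<beta>)) / 2"
  have t: "t > 0" and r: "r > 0" using sqrt_s1_bounds by (auto simp: t_def r_def)
  have rt: "r + t = lam + \<beta>" by (simp add: r_def t_def field_simps)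
  have c: "c = \<beta> / t" by (simp add: c_def t_def)
  have g: "g = lam / r" by (simp add: g_def gamma1_def r_def)
  have "s1 lam \<mu> \<alpha> \<beta> \<ge> 0" using pos by (simp add: s1_def)
  moreover have "2 * t - (lam + \<beta> - \<mu> - \<alpha>) = sqrt (s1 lam \<mu> \<alpha> \<beta>)"
    by (simp add: t_def field_simps)
  ultimately have "(2 * t - (lam + \<beta> - \<mu> - \<alpha>))\<^sup>2 = s1 lam \<mu> \<alpha> \<beta>"
    by simp
  then have t2: "t * t = (lam + \<beta> - \<mu> - \<alpha>) * t + \<alpha> * (lam + \<beta>)"
    by (simp add: s1_def power2_eq_square algebra_simps)
  show "lam / g + \<beta> / c = lam + \<beta>" using c g rt pos by simp
  have "r * (r * t) + \<mu> * lam * t + \<alpha> * \<beta> * r = (lam + \<mu> + \<alpha>) * (r * t)"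
  proof -
    have r': "r = lam + \<beta> - t" using rt by simp
    show ?thesis using t2 unfolding r' by algebra
  qed
  then have "r + \<mu> * (lam / r) + \<alpha> * (\<beta> / t) = lam + \<mu> + \<alpha>"
    using t r by (simp add: field_simps)
  then show "lam / g + \<mu> * g + \<alpha> * c = lam + \<mu> + \<alpha>" using c g pos by simp
qed

lemma infsum_free_jump:
  "(\<Sum>\<^sub>\<infinity>w\<in>-{(m, y, Up)}. free_jump C lam \<mu> \<alpha> \<beta> (m, y, Up) w) =
     (lam + (if y \<ge> 1 then \<mu> else 0) + \<mu> + \<alpha>) / C" (is ?U)
  "(\<Sum>\<^sub>\<infinity>w\<in>-{(m, y, Down)}. free_jump C lam \<mu> \<alpha> \<beta> (m, y, Down) w) =
     (lam + (if y \<ge> 1 then \<mu> else 0) + \<beta>) / C" (is ?D)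
proof -
  have "(\<Sum>\<^sub>\<infinity>w\<in>-{(m, y, Up)}. free_jump C lam \<mu> \<alpha> \<beta> (m, y, Up) w) =
      (\<Sum>\<^sub>\<infinity>w\<in>{(m, y + 1, Up), (m + 1, y - 1, Up), (m - 1, y, Up), (m, y, Down)}. free_jump C lam \<mu> \<alpha> \<beta> (m, y, Up) w)"
    by (rule infsum_cong_neutral) (auto split: if_splits)
  then show ?U by (auto simp: add_divide_distrib)
  have "(\<Sum>\<^sub>\<infinity>w\<in>-{(m, y, Down)}. free_jump C lam \<mu> \<alpha> \<beta> (m, y, Down) w) =
      (\<Sum>\<^sub>\<infinity>w\<in>{(m, y + 1, Down), (m + 1, y - 1, Down), (m, y, Up)}. free_jump C lam \<mu> \<alpha> \<beta> (m, y, Down) w)"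
    by (rule infsum_cong_neutral) (auto split: if_splits)
  then show ?D by (auto simp: add_divide_distrib)
qed

lemma twisted_kernel_ok:
  defines "T \<equiv> \<lambda>z z'. free_kernel C lam \<mu> \<alpha> \<beta> z z' * twist_h lam \<mu> \<alpha> \<beta> z' / twist_h lam \<mu> \<alpha> \<beta> z"
  shows "T z z' \<ge> 0" "(\<integral>\<^sup>+z'. ennreal (T z z') \<partial>count_space UNIV) = 1"
proof -
  have C0: "C > 0" using C pos by linarith
  have kernel_nonneg: "free_kernel C lam \<mu> \<alpha> \<beta> w w' \<ge> 0" for w w'
  proof (cases "w' = w")
    case True
    obtain m y s where w: "w = (m, y, s)" by (cases w)
    show ?thesis
    proof (cases s)
      case Up
      with True w show ?thesis using C0 C pos by (simp add: free_kernel_def infsum_free_jump)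
    next
      case Down
      with True w show ?thesis using C0 C pos by (simp add: free_kernel_def infsum_free_jump)
    qed
  next
    case False
    then show ?thesis using C0 pos
      by (cases "(C, lam, \<mu>, \<alpha>, \<beta>, w, w')" rule: free_jump.cases) (auto simp: free_kernel_def)
  qed
  show nonneg: "T z z' \<ge> 0" for z z'
    using kernel_nonneg twist_h_pos[of z] twist_h_pos[of z'] by (simp add: T_def)
  obtain m y s where z: "z = (m, y, s)" by (cases z)
  define g where "g = gamma1 lam \<mu> \<alpha> \<beta>"
  define c where "c = 2 * \<beta> / (lam + \<beta> - \<mu> - \<alpha> + sqrt (s1 lam \<mu> \<alpha> \<beta>))"
  have g: "g > 0" using gamma1_pos by (simp add: g_def)
  have c: "c > 0" using sqrt_s1_bounds pos by (simp add: c_def)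
  have h: "twist_h lam \<mu> \<alpha> \<beta> (x, v, Up) = g powi (- (x + int v))"
    "twist_h lam \<mu> \<alpha> \<beta> (x, v, Down) = g powi (- (x + int v)) * c" for x v
    by (simp_all add: g_def c_def)
  have pw: "g powi (- (m + (1 + int y))) = g powi (- (m + int y)) / g"
    "g powi (- (m - 1 + int y)) = g powi (- (m + int y)) * g"
    using g by (simp_all add: power_int_diff power_int_add power_int_minus divide_simps)
  define p where "p = g powi (- (m + int y))"
  have p: "p > 0" using g by (simp add: p_def)
  have e: "lam / g + \<mu> * g + \<alpha> * c = lam + \<mu> + \<alpha>" "lam / g + \<beta> / c = lam + \<beta>"
    using twist_h_harmonic by (simp_all add: g_def c_def)
  define A where "A = {(m, y, s), (m, y + 1, s), (m, y, if s = Up then Down else Up)}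
     \<union> (if y \<ge> 1 then {(m + 1, y - 1, s)} else {}) \<union> (if s = Up then {(m - 1, y, Up)} else {})"
  have fin: "finite A" by (simp add: A_def)
  have zero: "T z w = 0" if "w \<notin> A" for w
  proof -
    obtain m' y' s' where w: "w = (m', y', s')" by (cases w)
    have "free_kernel C lam \<mu> \<alpha> \<beta> z w = 0"
      using that by (cases s; cases s'; simp add: w z A_def free_kernel_def split: if_splits; blast)
    then show ?thesis by (simp add: T_def)
  qed
  have "(\<integral>\<^sup>+w. ennreal (T z w) \<partial>count_space UNIV) = (\<Sum>w\<in>A. ennreal (T z w))"
    using zero by (intro nn_integral_count_space'[OF fin]) auto
  also have "\<dots> = ennreal (\<Sum>w\<in>A. T z w)"
    by (rule sum_ennreal) (rule nonneg)
  also have "(\<Sum>w\<in>A. T z w) = 1"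
  proof (cases s)
    case Up
    have sum: "(\<Sum>w\<in>A. T z w) = T z (m, y, Up) + T z (m, y + 1, Up) + T z (m, y, Down)
        + (if y \<ge> 1 then T z (m + 1, y - 1, Up) else 0) + T z (m - 1, y, Up)"
      using Up by (simp add: A_def)
    have 1: "T z (m, y, Up) = 1 - (lam + (if y \<ge> 1 then \<mu> else 0) + \<mu> + \<alpha>) / C"
      using g p Up z gamma1_pos sqrt_s1_bounds pos by (simp add: T_def free_kernel_def infsum_free_jump)
    have 2: "T z (m, y + 1, Up) = lam / C / g"
      using g p Up z pw by (simp add: T_def free_kernel_def h p_def del: twist_h.simps)
    have 3: "T z (m, y, Down) = \<alpha> / C * c"
      using g p Up z pw by (simp add: T_def free_kernel_def h p_def del: twist_h.simps)
    have 4: "T z (m + 1, y - 1, Up) = \<mu> / C" if "y \<ge> 1"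
      using g p Up z that by (simp add: T_def free_kernel_def h p_def of_nat_diff del: twist_h.simps)
    have 5: "T z (m - 1, y, Up) = \<mu> / C * g"
      using g p Up z pw by (simp add: T_def free_kernel_def h p_def del: twist_h.simps)
    have "(\<Sum>w\<in>A. T z w) = 1 + ((lam / g + \<mu> * g + \<alpha> * c) - (lam + \<mu> + \<alpha>)) / C"
      unfolding sum 1 2 3 5 using 4 by (simp add: add_divide_distrib diff_divide_distrib mult.commute)
    then show ?thesis using e by simp
  next
    case Down
    have sum: "(\<Sum>w\<in>A. T z w) = T z (m, y, Down) + T z (m, y + 1, Down) + T z (m, y, Up)
        + (if y \<ge> 1 then T z (m + 1, y - 1, Down) else 0)"
      using Down by (simp add: A_def)
    have 1: "T z (m, y, Down) = 1 - (lam + (if y \<ge> 1 then \<mu> else 0) + \<beta>) / C"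
      using p Down z gamma1_pos sqrt_s1_bounds pos by (simp add: T_def free_kernel_def infsum_free_jump)
    have 2: "T z (m, y + 1, Down) = lam / C / g"
      using g p c Down z pw by (simp add: T_def free_kernel_def h p_def del: twist_h.simps)
    have 3: "T z (m, y, Up) = \<beta> / C / c"
      using g p c Down z pw by (simp add: T_def free_kernel_def h p_def del: twist_h.simps)
    have 4: "T z (m + 1, y - 1, Down) = \<mu> / C" if "y \<ge> 1"
      using g p c Down z that by (simp add: T_def free_kernel_def h p_def of_nat_diff del: twist_h.simps)
    have "(\<Sum>w\<in>A. T z w) = 1 + ((lam / g + \<beta> / c) - (lam + \<beta>)) / C"
      unfolding sum 1 2 3 using 4 by (simp add: add_divide_distrib diff_divide_distrib mult.commute)
    then show ?thesis using e by simp
  qed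
  finally show "(\<integral>\<^sup>+z'. ennreal (T z z') \<partial>count_space UNIV) = 1" by simp
qed

lemma pmf_twisted_kernel:
  "pmf (twisted_kernel C lam \<mu> \<alpha> \<beta> z) z' =
     free_kernel C lam \<mu> \<alpha> \<beta> z z' * twist_h lam \<mu> \<alpha> \<beta> z' / twist_h lam \<mu> \<alpha> \<beta> z"
  unfolding twisted_kernel_def by (intro pmf_embed_pmf twisted_kernel_ok)

end

end

theory Submission
  imports Defs
begin

text \<open>Server 2 is an M/M/1 queue with Poisson output, so the stationary distribution has product form:
  geometric of ratio \<open>lam / \<mu>\<close> in \<open>y\<close>, times the stationary law of an unreliable M/M/1 queue, which is a
  combination of two geometric sequences. This gives the asymptotics with an explicit constant, and it remains
  to evaluate \<open>eta2\<close>.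

  The function \<open>h * H\<close>, killed where the first coordinate is not positive, is harmonic for the free process,
  and its sums \<open>\<Phi> n\<close> over \<open>y\<close> against the geometric law are harmonic for server 1 alone. Pairing \<open>\<Phi>\<close> with
  the stationary law of server 1 therefore yields a flux between the levels \<open>n\<close> and \<open>n + 1\<close> that does not
  depend on \<open>n\<close>. At \<open>n = 0\<close> it is \<open>eta2\<close> up to a constant factor. As \<open>n\<close> tends to infinity, its limit
  is explicit because \<open>H\<close> tends to 1, which follows from an explicit superharmonic function.\<close>

section \<open>Uniqueness of invariant measures\<close>

text \<open>The law \<open>\<pi>\<close> is known only through stationarity, so its product form
  rests on a uniqueness theorem for invariant measures. It yields the constants
  \<open>N * lead\<close> and \<open>N * (lead * (\<alpha> / t))\<close> with a normalisation
  \<open>N\<close>, while the stated ones are built on \<open>eta2\<close>, which is defined through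
  escape probabilities; \<open>N\<close> drops out because \<open>eta2\<close> is linear in
  \<open>\<pi>\<close>. The other constants describe the twisted process. In it server 2 has arrival
  rate \<open>r\<close> and service rate \<open>\<mu>\<close>, and is empty with stationary
  probability \<open>B_const = 1 - r / \<mu>\<close>. The status leaves Up at rate
  \<open>\<alpha> * \<beta> / t\<close> and Down at rate \<open>t\<close>, with sum
  \<open>G_const\<close>. The drift of the first coordinate is \<open>C * d2_tilde\<close> in
  continuous time. The flux at infinity is this drift times the limiting mass
  \<open>lead * G_const / (t * B_const)\<close> of a level, and solving for \<open>lead\<close>
  gives the quotient in \<open>C2\<close>.\<close>

text \<open>Under the generator, the positive part of an invariant signed measure can only gain mass
  at each state. Bounded exit rates force the total gain to be zero, so the positive part is itself
  invariant, and irreducibility spreads one zero of it to all states. Applied to the difference of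
  two probability distributions, this is uniqueness of the stationary distribution.\<close>

lemma invariant_signed_measure_eq_0:
  fixes q :: "'a \<Rightarrow> 'a \<Rightarrow> real" and \<delta> :: "'a \<Rightarrow> real"
  assumes nonneg: "\<And>z z'. q z z' \<ge> 0"
    and summable_q: "\<And>z. q z summable_on -{z}"
    and bounded_q: "\<And>z. (\<Sum>\<^sub>\<infinity>w\<in>-{z}. q z w) \<le> c"
    and irreducible: "\<And>z z'. (z, z') \<in> {(w, w'). w \<noteq> w' \<and> q w w' > 0}\<^sup>*"
    and summable_\<delta>: "\<delta> summable_on UNIV" and mass: "(\<Sum>\<^sub>\<infinity>z. \<delta> z) = 0"
    and invariant: "\<And>z'. (\<Sum>\<^sub>\<infinity>z. \<delta> z * generator q z z') = 0"
  shows "\<delta> z = 0"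
proof -
  define Q where "Q = generator q"
  define m where "m z = max (\<delta> z) 0" for z
  have Q_nonneg: "Q z z' \<ge> 0" if "z \<noteq> z'" for z z'
    using nonneg that by (simp add: Q_def generator_def)
  have out_nonneg: "(\<Sum>\<^sub>\<infinity>w\<in>-{z}. q z w) \<ge> 0" for z
    by (intro infsum_nonneg nonneg)
  have off: "(Q z has_sum (\<Sum>\<^sub>\<infinity>w\<in>-{z}. q z w)) (-{z})" for z
    using has_sum_infsum[OF summable_q[of z]]
    by (rule has_sum_cong[THEN iffD1, rotated]) (auto simp: Q_def generator_def)
  have row: "(Q z has_sum 0) UNIV" for z
  proof -
    have "(Q z has_sum (Q z z + (\<Sum>\<^sub>\<infinity>w\<in>-{z}. q z w))) ({z} \<union> -{z})"
      by (rule has_sum_Un_disjoint[OF _ off]) (use has_sum_finite[of "{z}" "Q z"] in auto)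
    then show ?thesis by (simp add: Q_def generator_def)
  qed
  have absrow: "((\<lambda>w. \<bar>Q z w\<bar>) has_sum (2 * (\<Sum>\<^sub>\<infinity>w\<in>-{z}. q z w))) UNIV" for z
  proof -
    have "((\<lambda>w. \<bar>Q z w\<bar>) has_sum (\<Sum>\<^sub>\<infinity>w\<in>-{z}. q z w)) (-{z})"
      using off[of z] by (rule has_sum_cong[THEN iffD1, rotated]) (use Q_nonneg in auto)
    then have "((\<lambda>w. \<bar>Q z w\<bar>) has_sum (\<bar>Q z z\<bar> + (\<Sum>\<^sub>\<infinity>w\<in>-{z}. q z w))) ({z} \<union> -{z})"
      by (rule has_sum_Un_disjoint[rotated]) (use has_sum_finite[of "{z}" "\<lambda>w. \<bar>Q z w\<bar>"] in auto)
    then show ?thesis using out_nonneg[of z] by (simp add: Q_def generator_def)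
  qed
  have Q_bound: "\<bar>Q z w\<bar> \<le> 2 * c" for z w
  proof -
    have "infsum (\<lambda>w. \<bar>Q z w\<bar>) {w} \<le> infsum (\<lambda>w. \<bar>Q z w\<bar>) UNIV"
      by (rule infsum_mono_neutral) (use absrow[of z] in \<open>auto simp: summable_on_def intro: has_sum_finite\<close>)
    then show ?thesis using infsumI[OF absrow[of z]] bounded_q[of z] by simp
  qed
  have abs_\<delta>: "(\<lambda>z. norm (\<delta> z)) summable_on UNIV"
    using summable_\<delta> summable_on_iff_abs_summable_on_real by blast
  have summable_\<delta>Q: "(\<lambda>z. \<delta> z * Q z z') summable_on UNIV" for z'
  proof (rule abs_summable_summable, rule Infinite_Sum.abs_summable_on_comparison_test)
    show "(\<lambda>z. norm (\<delta> z * (2 * c))) summable_on UNIV"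
      using summable_on_cmult_left[OF abs_\<delta>, of "\<bar>2 * c\<bar>"] by (simp add: abs_mult)
    show "norm (\<delta> z * Q z z') \<le> norm (\<delta> z * (2 * c))" for z
      using Q_bound[of z z'] by (auto simp: abs_mult intro!: mult_left_mono)
  qed
  have abs_m: "(\<lambda>z. norm (m z)) summable_on UNIV"
    using abs_\<delta> by (rule Infinite_Sum.abs_summable_on_comparison_test) (auto simp: m_def)
  \<comment> \<open>Absolute summability allows the sums over source and target to be exchanged;
    each row has absolute sum at most \<open>2 * c\<close>.\<close>
  have double: "(\<lambda>x. norm (case x of (z, z') \<Rightarrow> m z * Q z z')) summable_on UNIV \<times> UNIV"
  proof (subst Infinite_Sum.abs_summable_on_Sigma_iff, intro conjI ballI)
    show "(\<lambda>z'. norm (case (z, z') of (z, z') \<Rightarrow> m z * Q z z')) summable_on UNIV" for z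
      using summable_on_cmult_right[of "\<lambda>w. \<bar>Q z w\<bar>" UNIV "\<bar>m z\<bar>"] absrow[of z]
      by (auto simp: abs_mult summable_on_def)
    have "(\<lambda>z. norm (m z * (2 * c))) summable_on UNIV"
      using summable_on_cmult_left[OF abs_m, of "\<bar>2 * c\<bar>"] by (simp add: abs_mult)
    moreover have "norm (\<Sum>\<^sub>\<infinity>z'. norm (case (z, z') of (z, z') \<Rightarrow> m z * Q z z')) \<le> norm (m z * (2 * c))" for z
    proof -
      have "(\<Sum>\<^sub>\<infinity>z'. norm (case (z, z') of (z, z') \<Rightarrow> m z * Q z z')) = \<bar>m z\<bar> * (2 * (\<Sum>\<^sub>\<infinity>w\<in>-{z}. q z w))"
        using infsumI[OF has_sum_cmult_right[OF absrow[of z], of "\<bar>m z\<bar>"]] by (simp add: abs_mult)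
      moreover have "\<bar>2 * (\<Sum>\<^sub>\<infinity>w\<in>-{z}. q z w)\<bar> \<le> \<bar>2 * c\<bar>"
        using bounded_q[of z] out_nonneg[of z] by simp
      ultimately show ?thesis
        unfolding real_norm_def by (simp only: abs_mult[of "\<bar>m z\<bar>"] abs_mult[of "m z"] abs_abs mult_left_mono abs_ge_zero)
    qed
    ultimately show "(\<lambda>z. norm (\<Sum>\<^sub>\<infinity>z'. norm (case (z, z') of (z, z') \<Rightarrow> m z * Q z z'))) summable_on UNIV"
      by (rule Infinite_Sum.abs_summable_on_comparison_test)
  qed
  then have double': "(\<lambda>(z, z'). m z * Q z z') summable_on UNIV \<times> UNIV"
    by (rule abs_summable_summable)
  have double'': "(\<lambda>(z', z). m z * Q z z') summable_on UNIV \<times> UNIV"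
    using summable_on_swap[of "\<lambda>(z, z'). m z * Q z z'" UNIV UNIV] double' by (simp add: case_prod_unfold)
  define L where "L z' = (\<Sum>\<^sub>\<infinity>z. m z * Q z z')" for z'
  have summable_mQ: "(\<lambda>z. m z * Q z z') summable_on UNIV" for z'
    using summable_on_SigmaD1[of "\<lambda>z' z. m z * Q z z'" UNIV "\<lambda>_. UNIV" z'] double'' by simp
  have zero_cond: "m z * Q z z' \<ge> 0" if "m z' = 0" for z z'
    using that Q_nonneg[of z z'] by (cases "z = z'") (auto simp: m_def)
  \<comment> \<open>Where \<open>\<delta>\<close> is positive, passing to \<open>m\<close> keeps the
    diagonal term and can only raise the others, and the sum was zero. Elsewhere the negative
    diagonal entry is multiplied by zero.\<close>
  have L_nonneg: "L z' \<ge> 0" for z'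
  proof (cases "\<delta> z' > 0")
    case True
    have "(\<Sum>\<^sub>\<infinity>z. \<delta> z * Q z z') \<le> L z'"
      unfolding L_def
    proof (rule infsum_mono[OF summable_\<delta>Q summable_mQ])
      show "\<delta> z * Q z z' \<le> m z * Q z z'" for z
        using True Q_nonneg[of z z'] by (cases "z = z'") (auto simp: m_def intro!: mult_right_mono)
    qed
    then show ?thesis using invariant by (simp add: Q_def)
  next
    case False
    then show ?thesis unfolding L_def by (intro infsum_nonneg zero_cond) (simp add: m_def)
  qed
  have "(\<Sum>\<^sub>\<infinity>z'. L z') = (\<Sum>\<^sub>\<infinity>z. \<Sum>\<^sub>\<infinity>z'. m z * Q z z')"
    unfolding L_def by (rule infsum_swap_banach[OF double''])
  also have "\<dots> = 0"
    using infsumI[OF has_sum_cmult_right[OF row]] by simp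
  finally have "L z' = 0" for z'
    using nonneg_infsum_le_0D[of L UNIV z'] L_nonneg summable_on_Sigma_banach[of "\<lambda>z' z. m z * Q z z'" UNIV "\<lambda>_. UNIV"] double''
    by (simp add: L_def[abs_def])
  \<comment> \<open>At a zero of \<open>m\<close> the sum \<open>L z'\<close> has only nonnegative
    terms and vanishes, so zeros propagate backwards along positive intensities.\<close>
  then have step: "m z = 0" if "m z' = 0" "z \<noteq> z'" "q z z' > 0" for z z'
  proof -
    have "m z * Q z z' = 0"
      by (rule nonneg_infsum_le_0D[OF _ summable_mQ[of z'] zero_cond[OF that(1)]])
        (use \<open>\<And>z'. L z' = 0\<close> in \<open>simp_all add: L_def\<close>)
    then show ?thesis using that by (auto simp: Q_def generator_def split: if_splits)
  qed
  obtain z\<^sub>0 where z\<^sub>0: "m z\<^sub>0 = 0"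
  proof (rule ccontr)
    assume "\<not> thesis"
    then have "m z \<noteq> 0" for z using that by blast
    then have pos: "\<delta> w > 0" for w
      unfolding m_def max_def by (metis not_le)
    have "\<delta> w = 0" for w
      by (rule nonneg_infsum_le_0D[OF _ summable_\<delta>]) (use pos in \<open>auto simp: mass less_imp_le\<close>)
    then show False using pos[of undefined] by simp
  qed
  have m0: "m z = 0" for z
    using irreducible[of z z\<^sub>0] by (induction rule: converse_rtrancl_induct) (use z\<^sub>0 step in auto)
  have "- \<delta> z \<ge> 0" for z using m0[of z] by (simp add: m_def max_def split: if_splits)
  moreover have "(\<lambda>z. - \<delta> z) summable_on UNIV" "(\<Sum>\<^sub>\<infinity>z. - \<delta> z) = 0"
    using mass summable_\<delta> by (simp_all add: infsum_uminus summable_on_uminus)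
  ultimately have "- \<delta> z = 0"
    using nonneg_infsum_le_0D[of "\<lambda>z. - \<delta> z" UNIV z] by simp
  then show ?thesis by simp
qed

lemma pmf_has_sum_1: "(pmf p has_sum 1) UNIV"
proof -
  have "(\<lambda>x. norm (pmf p x)) summable_on UNIV"
    using pmf_abs_summable[of p UNIV] abs_summable_equivalent by blast
  then have "pmf p summable_on UNIV" by (rule abs_summable_summable)
  moreover have "infsum (pmf p) UNIV = 1"
    using infsetsum_infsum[OF pmf_abs_summable[of p UNIV]] infsetsum_pmf_eq_1[of p UNIV]
    by (metis subset_UNIV)
  ultimately show ?thesis by (metis has_sum_infsum)
qed

text \<open>Makes \<open>free_state\<close> countable, so that an event about finitely many steps is
  a countable union of cylinders.\<close>

instance status :: countable by countable_datatype

section \<open>Survival probabilities\<close>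

fun path_prob :: "('a \<Rightarrow> 'a pmf) \<Rightarrow> 'a \<Rightarrow> 'a list \<Rightarrow> real" where
  "path_prob K z [] = 1"
| "path_prob K z (z' # p) = pmf (K z) z' * path_prob K z' p"

lemma path_prob_nonneg: "path_prob K z p \<ge> 0"
  by (induction p arbitrary: z) auto

lemma path_prob_eq: "path_prob K z p = (\<Prod>i<length p. pmf (K ((z # p) ! i)) ((z # p) ! Suc i))"
  by (induction p arbitrary: z) (simp_all add: prod.lessThan_Suc_shift del: prod.lessThan_Suc)

text \<open>The probability of lying in \<open>A\<close> at the times 1 to \<open>n\<close>. The
  starting point is not tested, because \<open>H_twisted\<close> is evaluated on level 0, outside
  the set in which the chain has to stay.\<close>

primrec survival :: "('a \<Rightarrow> 'a pmf) \<Rightarrow> 'a set \<Rightarrow> nat \<Rightarrow> 'a \<Rightarrow> real" where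
  "survival K A 0 z = 1"
| "survival K A (Suc n) z = (\<integral>z'. indicator A z' * survival K A n z' \<partial>measure_pmf (K z))"

lemma survival_bounds: "0 \<le> survival K A n z \<and> survival K A n z \<le> 1"
proof (induction n arbitrary: z)
  case (Suc n)
  have "(\<integral>z'. indicator A z' * survival K A n z' \<partial>measure_pmf (K z)) \<le> (\<integral>z'. 1 \<partial>measure_pmf (K z))"
    by (intro integral_mono measure_pmf.integrable_const_bound[where B=1])
      (use Suc in \<open>auto simp: abs_mult indicator_def\<close>)
  then show ?case using Suc by (auto intro!: integral_nonneg)
qed simp

text \<open>Splitting off the first state of a path reproduces the recursion of
  \<open>survival\<close>. This links cylinder probabilities with expectations under the
  kernel.\<close>

lemma sum_path_prob:
  "(\<integral>\<^sup>+p. ennreal (path_prob K z p) \<partial>count_space {p. length p = n \<and> set p \<subseteq> A}) = ennreal (survival K A n z)"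
proof (induction n arbitrary: z)
  case 0
  have "{p. length p = 0 \<and> set p \<subseteq> A} = {[]}" by auto
  then show ?case by (simp add: nn_integral_count_space_finite)
next
  case (Suc n)
  let ?P = "{p. length p = n \<and> set p \<subseteq> A}"
  have bij: "bij_betw (\<lambda>(z', p). z' # p) (A \<times> ?P) {p. length p = Suc n \<and> set p \<subseteq> A}"
    by (rule bij_betwI[where g="\<lambda>p. (hd p, tl p)"]) (auto simp: length_Suc_conv)
  have "(\<integral>\<^sup>+p. ennreal (path_prob K z p) \<partial>count_space {p. length p = Suc n \<and> set p \<subseteq> A}) =
      (\<integral>\<^sup>+(z', p). ennreal (path_prob K z (z' # p)) \<partial>count_space (A \<times> ?P))"
    by (subst nn_integral_bij_count_space[OF bij, symmetric]) (simp add: case_prod_unfold)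
  also have "\<dots> = (\<integral>\<^sup>+z'. \<integral>\<^sup>+p. ennreal (path_prob K z (z' # p)) \<partial>count_space ?P \<partial>count_space A)"
    by (subst (1 2 3) nn_integral_count_space_indicator)
      (auto simp: nn_integral_fst_count_space[symmetric] nn_integral_multc[symmetric]
         intro!: nn_integral_cong split: split_indicator)
  also have "\<dots> = (\<integral>\<^sup>+z'. ennreal (pmf (K z) z') * ennreal (survival K A n z') \<partial>count_space A)"
    by (intro nn_integral_cong) (simp add: ennreal_mult path_prob_nonneg nn_integral_cmult Suc)
  also have "\<dots> = (\<integral>\<^sup>+z'. ennreal (pmf (K z) z') * ennreal (indicator A z' * survival K A n z') \<partial>count_space UNIV)"
    by (subst nn_integral_count_space_indicator) (auto intro!: nn_integral_cong split: split_indicator)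
  also have "\<dots> = (\<integral>\<^sup>+z'. ennreal (indicator A z' * survival K A n z') \<partial>measure_pmf (K z))"
    by (simp add: nn_integral_measure_pmf)
  also have "\<dots> = ennreal (survival K A (Suc n) z)"
    unfolding survival.simps
    by (intro nn_integral_eq_integral measure_pmf.integrable_const_bound[where B=1])
      (use survival_bounds[of K A n] in \<open>auto simp: abs_mult indicator_def\<close>)
  finally show ?case .
qed

lemma sets_chain_law: "sets (chain_law K z) = sets (PiM UNIV (\<lambda>_. count_space UNIV))"
proof -
  interpret IT: Ionescu_Tulcea "chain_step K z" "\<lambda>_. count_space UNIV" by (rule Ionescu_Tulcea_chain_step)
  show ?thesis unfolding chain_law_def by (rule IT.PF.sets_lim)
qed

text \<open>The event is the disjoint union of the cylinders fixing the first \<open>n + 1\<close>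
  states; those that do not begin with \<open>z\<close> have measure 0.\<close>

lemma emeasure_chain_law_survival:
  fixes z :: "'a :: countable"
  shows "emeasure (chain_law K z) {\<omega>. \<forall>i\<in>{1..n}. \<omega> i \<in> A} = ennreal (survival K A n z)"
proof -
  let ?I = "{p :: 'a list. length p = Suc n \<and> set (tl p) \<subseteq> A}"
  define X where "X p = {\<omega>. \<forall>i\<le>n. \<omega> i = p ! i}" for p :: "'a list"
  have X_sets: "X p \<in> sets (chain_law K z)" for p
  proof -
    have "X p = {\<omega> \<in> space (PiM UNIV (\<lambda>_. count_space UNIV)). \<forall>i\<in>{..n}. \<omega> i \<in> {p ! i}}"
      by (auto simp: X_def space_PiM)
    also have "\<dots> \<in> sets (PiM UNIV (\<lambda>_. count_space UNIV))"
      by measurable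
    finally show ?thesis by (simp add: sets_chain_law)
  qed
  have "{\<omega>. \<forall>i\<in>{1..n}. \<omega> i \<in> A} = (\<Union>p\<in>?I. X p)"
  proof (intro equalityI subsetI)
    fix \<omega> :: "nat \<Rightarrow> 'a" assume \<omega>: "\<omega> \<in> {\<omega>. \<forall>i\<in>{1..n}. \<omega> i \<in> A}"
    have "set (tl (map \<omega> [0..<Suc n])) \<subseteq> A"
      using \<omega> by (auto simp: map_tl[symmetric] tl_upt simp del: upt_Suc)
    moreover have "\<omega> \<in> X (map \<omega> [0..<Suc n])" by (auto simp: X_def simp del: upt_Suc)
    ultimately show "\<omega> \<in> (\<Union>p\<in>?I. X p)" by (auto simp del: upt_Suc intro!: exI[of _ "map \<omega> [0..<Suc n]"])
  next
    fix \<omega> assume "\<omega> \<in> (\<Union>p\<in>?I. X p)"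
    then obtain p where p: "length p = Suc n" "set (tl p) \<subseteq> A" "\<And>i. i \<le> n \<Longrightarrow> \<omega> i = p ! i"
      by (auto simp: X_def)
    have "\<omega> i \<in> A" if "i \<in> {1..n}" for i
    proof -
      have "p ! i = tl p ! (i - 1)" "i - 1 < length (tl p)" using that p by (auto simp: nth_tl)
      then show ?thesis using p that by (metis atLeastAtMost_iff nth_mem subsetD)
    qed
    then show "\<omega> \<in> {\<omega>. \<forall>i\<in>{1..n}. \<omega> i \<in> A}" by blast
  qed
  moreover have "disjoint_family_on X ?I"
    unfolding disjoint_family_on_def
  proof (intro ballI impI)
    fix p p' assume "p \<in> ?I" "p' \<in> ?I" "p \<noteq> p'"
    then obtain i where "i \<le> n" "p ! i \<noteq> p' ! i"
      by (metis (mono_tags, lifting) less_Suc_eq_le mem_Collect_eq nth_equalityI)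
    then show "X p \<inter> X p' = {}" by (auto simp: X_def)
  qed
  ultimately have "emeasure (chain_law K z) {\<omega>. \<forall>i\<in>{1..n}. \<omega> i \<in> A} =
      (\<integral>\<^sup>+p. emeasure (chain_law K z) (X p) \<partial>count_space ?I)"
    using X_sets by (simp add: emeasure_UN_countable)
  also have "\<dots> = (\<integral>\<^sup>+p. (if hd p = z then ennreal (path_prob K z (tl p)) else 0) \<partial>count_space ?I)"
  proof (rule nn_integral_cong)
    fix p assume "p \<in> space (count_space ?I)"
    then obtain w p' where p: "p = w # p'" "length p' = n" by (auto simp: length_Suc_conv)
    show "emeasure (chain_law K z) (X p) = (if hd p = z then ennreal (path_prob K z (tl p)) else 0)"
      using emeasure_chain_law_cylinder[of K z n "\<lambda>i. p ! i"]
      by (simp add: X_def p path_prob_eq)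
  qed
  also have "\<dots> = (\<integral>\<^sup>+p. ennreal (path_prob K z (tl p)) \<partial>count_space ((#) z ` {p. length p = n \<and> set p \<subseteq> A}))"
  proof -
    have "(#) z ` {p. length p = n \<and> set p \<subseteq> A} = {p\<in>?I. hd p = z}"
      by (auto simp: length_Suc_conv)
    moreover have "(\<integral>\<^sup>+p. (if hd p = z then ennreal (path_prob K z (tl p)) else 0) \<partial>count_space ?I)
        = (\<integral>\<^sup>+p. ennreal (path_prob K z (tl p)) \<partial>count_space {p\<in>?I. hd p = z})"
      by (subst (1 2) nn_integral_count_space_indicator) (auto intro!: nn_integral_cong split: split_indicator)
    ultimately show ?thesis by simp
  qed
  also have "\<dots> = (\<integral>\<^sup>+p. ennreal (path_prob K z p) \<partial>count_space {p. length p = n \<and> set p \<subseteq> A})"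
    by (subst nn_integral_bij_count_space[where g="(#) z", symmetric])
      (auto simp: bij_betw_def)
  also have "\<dots> = ennreal (survival K A n z)" by (rule sum_path_prob)
  finally show ?thesis .
qed

definition survival_forever :: "('a \<Rightarrow> 'a pmf) \<Rightarrow> 'a set \<Rightarrow> 'a \<Rightarrow> real" where
  "survival_forever K A z = measure (chain_law K z) {\<omega>. \<forall>n\<ge>1. \<omega> n \<in> A}"

lemma survival_tendsto:
  fixes z :: "'a :: countable"
  shows "(\<lambda>n. survival K A n z) \<longlonglongrightarrow> survival_forever K A z"
proof -
  define E where "E n = {\<omega> :: nat \<Rightarrow> 'a. \<forall>i\<in>{1..n}. \<omega> i \<in> A}" for n
  have em: "emeasure (chain_law K z) (E n) = ennreal (survival K A n z)" for n
    unfolding E_def by (rule emeasure_chain_law_survival)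
  have "E n \<in> sets (chain_law K z)" for n
  proof -
    have "E n = {\<omega> \<in> space (PiM UNIV (\<lambda>_. count_space UNIV)). \<forall>i\<in>{1..n}. \<omega> i \<in> A}"
      by (auto simp: E_def space_PiM)
    also have "\<dots> \<in> sets (PiM UNIV (\<lambda>_. count_space UNIV))"
      by measurable
    finally show ?thesis by (simp add: sets_chain_law)
  qed
  then have "(\<lambda>n. emeasure (chain_law K z) (E n)) \<longlonglongrightarrow> emeasure (chain_law K z) (\<Inter>n. E n)"
    by (intro Lim_emeasure_decseq) (auto simp: decseq_def em, auto simp: E_def)
  moreover have "(\<Inter>n. E n) = {\<omega>. \<forall>n\<ge>1. \<omega> n \<in> A}"
    by (fastforce simp: E_def)
  ultimately have lim: "(\<lambda>n. ennreal (survival K A n z)) \<longlonglongrightarrow> emeasure (chain_law K z) {\<omega>. \<forall>n\<ge>1. \<omega> n \<in> A}"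
    by (simp add: em)
  then have "emeasure (chain_law K z) {\<omega>. \<forall>n\<ge>1. \<omega> n \<in> A} \<le> 1"
    by (rule LIMSEQ_le_const2) (use survival_bounds[of K A _ z] in auto)
  then have "emeasure (chain_law K z) {\<omega>. \<forall>n\<ge>1. \<omega> n \<in> A} \<noteq> top"
    by (rule neq_top_trans[OF ennreal_one_neq_top])
  then have "emeasure (chain_law K z) {\<omega>. \<forall>n\<ge>1. \<omega> n \<in> A} = ennreal (survival_forever K A z)"
    unfolding survival_forever_def by (rule emeasure_eq_ennreal_measure)
  then show ?thesis
    using lim survival_bounds[of K A _ z]
    by (subst tendsto_ennreal_iff[symmetric]) (auto simp: survival_forever_def)
qed

lemma survival_forever_bounds:
  fixes z :: "'a :: countable"
  shows "0 \<le> survival_forever K A z" "survival_forever K A z \<le> 1"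
  using LIMSEQ_le_const2[OF survival_tendsto[of K A z]] survival_bounds[of K A _ z]
  by (auto simp: survival_forever_def)

lemma survival_forever_first_step:
  fixes z :: "'a :: countable"
  shows "survival_forever K A z = (\<integral>z'. indicator A z' * survival_forever K A z' \<partial>measure_pmf (K z))"
proof (rule LIMSEQ_unique)
  show "(\<lambda>n. survival K A (Suc n) z) \<longlonglongrightarrow> survival_forever K A z"
    by (rule LIMSEQ_Suc[OF survival_tendsto])
  show "(\<lambda>n. survival K A (Suc n) z) \<longlonglongrightarrow> (\<integral>z'. indicator A z' * survival_forever K A z' \<partial>measure_pmf (K z))"
    unfolding survival.simps
    by (rule integral_dominated_convergence[where w="\<lambda>_. 1"])
      (use survival_bounds[of K A] in \<open>auto intro!: tendsto_mult survival_tendsto simp: abs_mult indicator_def\<close>)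
qed

text \<open>\<open>V\<close> bounds the probability of ever leaving \<open>A\<close> after time 0:
  it is at least 1 outside \<open>A\<close>, and superharmonicity keeps \<open>1 - V\<close> below
  the probability of surviving \<open>n\<close> steps, for each \<open>n\<close>.\<close>

lemma survival_forever_ge:
  fixes z :: "'a :: countable"
  assumes V: "\<And>z. V z \<ge> 0" "\<And>z. z \<notin> A \<Longrightarrow> V z \<ge> 1"
    and integrable: "\<And>z. integrable (measure_pmf (K z)) V"
    and superharmonic: "\<And>z. (\<integral>z'. V z' \<partial>measure_pmf (K z)) \<le> V z"
  shows "survival_forever K A z \<ge> 1 - V z"
proof -
  have "survival K A n z \<ge> 1 - V z" for n
  proof (induction n arbitrary: z)
    case 0
    show ?case using V(1)[of z] by simp
  next
    case (Suc n)
    have "1 - V z \<le> 1 - (\<integral>z'. V z' \<partial>measure_pmf (K z))"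
      using superharmonic[of z] by simp
    also have "\<dots> = (\<integral>z'. 1 - V z' \<partial>measure_pmf (K z))"
      using integrable by simp
    also have "\<dots> \<le> (\<integral>z'. indicator A z' * survival K A n z' \<partial>measure_pmf (K z))"
    proof (rule integral_mono)
      show "integrable (measure_pmf (K z)) (\<lambda>z'. 1 - V z')" using integrable by simp
      show "integrable (measure_pmf (K z)) (\<lambda>z'. indicator A z' * survival K A n z')"
        by (intro measure_pmf.integrable_const_bound[where B=1])
          (use survival_bounds[of K A n] in \<open>auto simp: abs_mult indicator_def\<close>)
      show "1 - V z' \<le> indicator A z' * survival K A n z'" for z'
        using Suc[of z'] V(2)[of z'] by (auto simp: indicator_def)
    qed
    finally show ?case by simp
  qed
  then show ?thesis by (intro LIMSEQ_le_const[OF survival_tendsto]) auto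
qed

section \<open>The parameters\<close>

locale tandem_queue =
  fixes lam \<mu> \<alpha> \<beta> C :: real
  assumes pos: "lam > 0" "\<mu> > 0" "\<alpha> > 0" "\<beta> > 0"
    and stable: "lam < \<beta> / (\<alpha> + \<beta>) * \<mu>"
    and uniformization: "C \<ge> lam + 2 * \<mu> + \<alpha> + \<beta>"
begin

text \<open>\<open>lam / r\<close> and \<open>lam / r'\<close> are the ratios of the two geometric solutions of the balance equations
  of server 1 with Poisson input; \<open>lam / r\<close> is \<open>gamma1\<close>.\<close>

definition r :: real where "r = (lam + \<beta> + \<mu> + \<alpha> - sqrt (s1 lam \<mu> \<alpha> \<beta>)) / 2"
definition r' :: real where "r' = (lam + \<beta> + \<mu> + \<alpha> + sqrt (s1 lam \<mu> \<alpha> \<beta>)) / 2"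
definition t :: real where "t = (lam + \<beta> - \<mu> - \<alpha> + sqrt (s1 lam \<mu> \<alpha> \<beta>)) / 2"

lemma C_pos: "C > 0"
  using uniformization pos by linarith

lemma r_pos: "r > 0" and t_pos: "t > 0"
  using sqrt_s1_bounds[OF pos uniformization] by (auto simp: r_def t_def)

lemma r_plus_t: "r + t = lam + \<beta>"
  by (simp add: r_def t_def field_simps)

lemma s1_pos: "s1 lam \<mu> \<alpha> \<beta> > 0"
  using pos by (simp add: s1_def add_nonneg_pos)

lemma r_sum_prod: "r + r' = lam + \<beta> + \<mu> + \<alpha>" "r * r' = \<mu> * (lam + \<beta>)"
proof -
  show "r + r' = lam + \<beta> + \<mu> + \<alpha>" by (simp add: r_def r'_def field_simps)
  have "r * r' = ((lam + \<beta> + \<mu> + \<alpha>)\<^sup>2 - (sqrt (s1 lam \<mu> \<alpha> \<beta>))\<^sup>2) / 4"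
    by (simp add: r_def r'_def power2_eq_square algebra_simps)
  also have "\<dots> = \<mu> * (lam + \<beta>)"
    using s1_pos by (simp add: s1_def power2_eq_square algebra_simps)
  finally show "r * r' = \<mu> * (lam + \<beta>)" .
qed

text \<open>Both are roots of one quadratic, arranged as the balance of the Down states of server 1
  for a geometric solution of ratio \<open>lam / p\<close>.\<close>

lemma char_poly:
  "(lam + \<beta>) * (\<mu> - r) = r * (\<alpha> + \<mu> - r)" "(lam + \<beta>) * (\<mu> - r') = r' * (\<alpha> + \<mu> - r')"
proof -
  have e: "\<alpha> + \<mu> - r = r' - (lam + \<beta>)" "\<alpha> + \<mu> - r' = r - (lam + \<beta>)"
    using r_sum_prod(1) by linarith+
  show "(lam + \<beta>) * (\<mu> - r) = r * (\<alpha> + \<mu> - r)" "(lam + \<beta>) * (\<mu> - r') = r' * (\<alpha> + \<mu> - r')"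
    using r_sum_prod(2) unfolding e by algebra+
qed

lemma t_r: "(\<mu> - r) * t = \<alpha> * r"
proof -
  have t: "t = lam + \<beta> - r" using r_plus_t by simp
  show ?thesis unfolding t using char_poly(1) by algebra
qed

lemma r_less: "r < \<mu>"
proof -
  have "(\<mu> - r) * t > 0" unfolding t_r using pos r_pos by simp
  then show ?thesis using t_pos by (simp add: zero_less_mult_iff)
qed

text \<open>The stability condition enters here. \<open>t\<close> is the positive root of
  \<open>x\<^sup>2 - (lam + \<beta> - \<mu> - \<alpha>) * x - \<alpha> * (lam + \<beta>)\<close>,
  whose value at \<open>\<beta>\<close> is
  \<open>\<mu> * \<beta> - lam * (\<alpha> + \<beta>)\<close>; as this is positive,
  \<open>\<beta>\<close> lies beyond \<open>t\<close>. Since \<open>r + t = lam + \<beta>\<close>,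
  the bound amounts to \<open>gamma1\<close> being below 1.\<close>

lemma t_less: "t < \<beta>"
proof -
  have "lam * (\<alpha> + \<beta>) < \<beta> * \<mu>"
    using stable pos by (simp add: field_simps)
  then have "0 < t * (\<mu> * \<beta> - lam * (\<alpha> + \<beta>))" using t_pos by (simp add: mult.commute)
  \<comment> \<open>The quadratic at \<open>\<beta>\<close>, times \<open>t\<close>, split into its
    linear factors; the last summand vanishes by \<open>t_r\<close>.\<close>
  also have "\<dots> = (\<beta> - t) * (t * \<beta> + \<alpha> * (lam + \<beta>)) + \<beta> * ((\<mu> - r) * t - \<alpha> * r)"
  proof -
    have r: "r = lam + \<beta> - t" using r_plus_t by simp
    show ?thesis unfolding r by (simp add: algebra_simps)
  qed
  also have "\<dots> = (\<beta> - t) * (t * \<beta> + \<alpha> * (lam + \<beta>))" by (simp add: t_r)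
  finally have "(\<beta> - t) * (t * \<beta> + \<alpha> * (lam + \<beta>)) > 0" .
  moreover have "t * \<beta> + \<alpha> * (lam + \<beta>) > 0" using pos t_pos by (simp add: add_pos_pos)
  ultimately have "\<beta> - t > 0" by (rule zero_less_mult_pos2)
  then show ?thesis by simp
qed

lemma lam_less: "lam < r"
  using t_less r_plus_t by linarith

lemma r'_greater: "\<mu> < r'"
proof -
  have "r < lam + \<beta>" using r_plus_t t_pos by simp
  then have "r * r' > \<mu> * r" unfolding r_sum_prod using pos by simp
  then show ?thesis using r_pos by (simp add: mult.commute)
qed

lemmas params_pos = pos r_pos t_pos C_pos

lemma gamma1_eq: "gamma1 lam \<mu> \<alpha> \<beta> = lam / r"
  by (simp add: gamma1_def r_def)

lemma B_const_eq: "B_const lam \<mu> \<alpha> \<beta> = 1 - r / \<mu>"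
  by (simp add: B_const_def r_def)

lemma G_const_eq: "G_const lam \<mu> \<alpha> \<beta> = t + \<alpha> * \<beta> / t"
  by (simp add: G_const_def t_def)

lemma twist_h_eq:
  "twist_h lam \<mu> \<alpha> \<beta> (m, y, s) = (lam / r) powi (- (m + int y)) * (if s = Up then 1 else \<beta> / t)"
  by (cases s) (simp_all add: gamma1_eq t_def)

text \<open>This form exhibits a drift: in the twisted process server 2 passes customers on at rate
  \<open>r\<close>, and server 1 loses them at rate \<open>\<mu> * lam / r\<close> during the
  fraction \<open>t / (t + \<alpha> * \<beta> / t)\<close> of time in which it is Up. Division by
  \<open>C\<close> turns rates into steps.\<close>

lemma d2_tilde_eq: "d2_tilde C lam \<mu> \<alpha> \<beta> = (r - lam * \<mu> * t / (r * (t + \<alpha> * \<beta> / t))) / C"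
proof -
  define a where "a = 4 * \<alpha> * \<beta> + (2 * t)\<^sup>2"
  have a: "a = 4 * t * (t + \<alpha> * \<beta> / t)"
    using t_pos by (simp add: a_def power2_eq_square field_simps)
  have G: "t + \<alpha> * \<beta> / t > 0" using params_pos by (simp add: add_pos_pos)
  have e: "lam + \<beta> - \<mu> - \<alpha> + sqrt (s1 lam \<mu> \<alpha> \<beta>) = 2 * t"
    "lam + \<beta> + \<mu> + \<alpha> - sqrt (s1 lam \<mu> \<alpha> \<beta>) = 2 * r"
    "lam + \<mu> + \<beta> + \<alpha> - sqrt (s1 lam \<mu> \<alpha> \<beta>) = 2 * r"
    by (simp_all add: r_def t_def)
  have "d2_tilde C lam \<mu> \<alpha> \<beta> = 1 / C * (r - 2 * lam * \<mu> * (2 * t)\<^sup>2 / ((2 * r) * a))"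
    unfolding d2_tilde_def e a_def by simp
  also have "2 * lam * \<mu> * (2 * t)\<^sup>2 / ((2 * r) * a) = lam * \<mu> * t / (r * (t + \<alpha> * \<beta> / t))"
    unfolding a using params_pos G by (simp add: power2_eq_square divide_simps)
  finally show ?thesis by simp
qed

text \<open>After clearing denominators the drift is a positive multiple of
  \<open>\<beta> - t\<close>, so its sign is given by \<open>t_less\<close>.\<close>

lemma d2_tilde_pos: "d2_tilde C lam \<mu> \<alpha> \<beta> > 0"
proof -
  have "r\<^sup>2 * (t\<^sup>2 + \<alpha> * \<beta>) - lam * \<mu> * t\<^sup>2 = r\<^sup>2 * t\<^sup>2 + r * \<beta> * (\<alpha> * r) - lam * \<mu> * t\<^sup>2"
    by (simp add: power2_eq_square algebra_simps)
  also have "\<dots> = t * ((\<beta> - t) * (r * (\<mu> - r) + \<mu> * t)) + (r + t - (lam + \<beta>)) * \<mu> * t\<^sup>2"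
    unfolding t_r[symmetric] by (simp add: power2_eq_square algebra_simps)
  also have "\<dots> = t * ((\<beta> - t) * (r * (\<mu> - r) + \<mu> * t))" by (simp add: r_plus_t)
  also have "\<dots> > 0" using params_pos t_less r_less by (simp add: add_pos_pos)
  finally have "lam * \<mu> * t < r * (r * (t + \<alpha> * \<beta> / t))"
    using t_pos by (simp add: power2_eq_square field_simps)
  moreover have "r * (t + \<alpha> * \<beta> / t) > 0" using params_pos by (simp add: add_pos_pos)
  ultimately have "lam * \<mu> * t / (r * (t + \<alpha> * \<beta> / t)) < r" by (simp only: pos_divide_less_eq)
  then show ?thesis
    unfolding d2_tilde_eq by (intro divide_pos_pos C_pos diff_gt_0_iff_gt[THEN iffD2])
qed

section \<open>The stationary distribution\<close>

lemma has_sum_rate: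
  "((\<lambda>w. rate lam \<mu> \<alpha> \<beta> (x, y, s) w) has_sum
      (lam + (if y \<ge> 1 then \<mu> else 0) + (if s = Up then (if x \<ge> 1 then \<mu> else 0) + \<alpha> else \<beta>))) (-{(x, y, s)})"
proof -
  define A where "A = {(x, y + 1, s), (x, y, if s = Up then Down else Up)}
     \<union> (if y \<ge> 1 then {(x + 1, y - 1, s)} else {}) \<union> (if s = Up \<and> x \<ge> 1 then {(x - 1, y, s)} else {})"
  have "(rate lam \<mu> \<alpha> \<beta> (x, y, s) has_sum (\<Sum>w\<in>A. rate lam \<mu> \<alpha> \<beta> (x, y, s) w)) A"
    by (intro has_sum_finite) (simp add: A_def)
  also have "(\<Sum>w\<in>A. rate lam \<mu> \<alpha> \<beta> (x, y, s) w) =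
      lam + (if y \<ge> 1 then \<mu> else 0) + (if s = Up then (if x \<ge> 1 then \<mu> else 0) + \<alpha> else \<beta>)"
    by (cases s) (auto simp: A_def)
  finally show ?thesis
  proof (rule has_sum_cong_neutral[THEN iffD1, rotated 3])
    fix w assume w: "w \<in> - {(x, y, s)} - A"
    obtain x' y' s' where [simp]: "w = (x', y', s')" by (cases w)
    show "rate lam \<mu> \<alpha> \<beta> (x, y, s) w = 0"
      using w by (cases s; cases s') (auto simp: A_def split: if_splits)
  qed (auto simp: A_def)
qed

text \<open>A state has at most four predecessors, so each column sum is finite for arbitrary
  \<open>f\<close>. In particular it is linear in \<open>f\<close>, as \<open>product_form\<close>
  requires.\<close>

lemma infsum_generator_rate:
  "(\<Sum>\<^sub>\<infinity>z. f z * generator (rate lam \<mu> \<alpha> \<beta>) z (x, y, Up)) =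
     (if y \<ge> 1 then lam * f (x, y - 1, Up) else 0) + (if x \<ge> 1 then \<mu> * f (x - 1, y + 1, Up) else 0)
     + \<mu> * f (x + 1, y, Up) + \<beta> * f (x, y, Down)
     - (lam + (if y \<ge> 1 then \<mu> else 0) + (if x \<ge> 1 then \<mu> else 0) + \<alpha>) * f (x, y, Up)" (is ?U)
  "(\<Sum>\<^sub>\<infinity>z. f z * generator (rate lam \<mu> \<alpha> \<beta>) z (x, y, Down)) =
     (if y \<ge> 1 then lam * f (x, y - 1, Down) else 0) + (if x \<ge> 1 then \<mu> * f (x - 1, y + 1, Down) else 0)
     + \<alpha> * f (x, y, Up) - (lam + (if y \<ge> 1 then \<mu> else 0) + \<beta>) * f (x, y, Down)" (is ?D)
proof -
  define A where "A s = {(x, y, s), (x, y, if s = Up then Down else Up)}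
     \<union> (if y \<ge> 1 then {(x, y - 1, s)} else {}) \<union> (if x \<ge> 1 then {(x - 1, y + 1, s)} else {})
     \<union> (if s = Up then {(x + 1, y, Up)} else {})" for s
  have fin: "finite (A s)" for s by (simp add: A_def)
  define g where "g = generator (rate lam \<mu> \<alpha> \<beta>)"
  have diag: "g (x, y, s) (x, y, s) =
      - (lam + (if y \<ge> 1 then \<mu> else 0) + (if s = Up then (if x \<ge> 1 then \<mu> else 0) + \<alpha> else \<beta>))" for x y s
    unfolding g_def generator_def infsumI[OF has_sum_rate] by simp
  have off: "g z z' = rate lam \<mu> \<alpha> \<beta> z z'" if "z' \<noteq> z" for z z'
    using that by (simp add: g_def generator_def)
  have red: "(\<Sum>\<^sub>\<infinity>z. f z * g z (x, y, s)) = (\<Sum>z\<in>A s. f z * g z (x, y, s))" for s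
  proof -
    have "(\<Sum>\<^sub>\<infinity>z. f z * g z (x, y, s)) = (\<Sum>\<^sub>\<infinity>z\<in>A s. f z * g z (x, y, s))"
    proof (rule infsum_cong_neutral)
      fix z assume z: "z \<in> UNIV - A s"
      obtain x' y' s' where [simp]: "z = (x', y', s')" by (cases z)
      have "z \<in> A s" if "rate lam \<mu> \<alpha> \<beta> z (x, y, s) \<noteq> 0"
        using that by (auto simp: A_def split: if_splits)
      then have "rate lam \<mu> \<alpha> \<beta> z (x, y, s) = 0" using z by blast
      moreover have "(x, y, s) \<noteq> z" using z by (auto simp: A_def)
      ultimately show "f z * g z (x, y, s) = 0" by (simp add: off)
    qed auto
    then show ?thesis using fin by simp
  qed
  show ?U unfolding g_def[symmetric] red
    by (cases x; cases y) (simp_all add: A_def diag off algebra_simps)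
  show ?D unfolding g_def[symmetric] red
    by (cases x; cases y) (simp_all add: A_def diag off algebra_simps)
qed

text \<open>All states communicate through \<open>(0, 0, Up)\<close>. On the way there, server 1 is
  repaired, receives all customers and serves them; on the way back, arrivals are passed on to
  server 1 as required and a failure may follow.\<close>

lemma irreducible:
  "(z, z') \<in> {(w, w'). w \<noteq> w' \<and> rate lam \<mu> \<alpha> \<beta> w w' > 0}\<^sup>*" (is "_ \<in> ?R\<^sup>*")
proof -
  have arrive: "((x, y, s), (x, Suc y, s)) \<in> ?R" for x y s using pos by auto
  have serve2: "((x, Suc y, s), (Suc x, y, s)) \<in> ?R" for x y s using pos by auto
  have serve1: "((Suc x, y, Up), (x, y, Up)) \<in> ?R" for x y using pos by auto
  have repair: "((x, y, Down), (x, y, Up)) \<in> ?R" for x y using pos by auto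
  have fail: "((x, y, Up), (x, y, Down)) \<in> ?R" for x y using pos by auto
  have to_Up: "((x, y, s), (x, y, Up)) \<in> ?R\<^sup>*" for x y s
    by (cases s) (use repair in auto)
  have empty2: "((x, y, s), (x + y, 0, s)) \<in> ?R\<^sup>*" for x y s
  proof (induction y arbitrary: x)
    case (Suc y)
    show ?case using converse_rtrancl_into_rtrancl[OF serve2 Suc[of "Suc x"]] by simp
  qed simp
  have empty1: "((x, y, Up), (0, y, Up)) \<in> ?R\<^sup>*" for x y
  proof (induction x)
    case (Suc x)
    show ?case by (rule converse_rtrancl_into_rtrancl[OF serve1 Suc])
  qed simp
  have fill2: "((x, 0, s), (x, y, s)) \<in> ?R\<^sup>*" for x y s
  proof (induction y)
    case (Suc y)
    show ?case by (rule rtrancl_into_rtrancl[OF Suc arrive])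
  qed simp
  have fill1: "((0, y, s), (x, y, s)) \<in> ?R\<^sup>*" for x y s
  proof (induction x)
    case (Suc x)
    show ?case by (rule rtrancl_into_rtrancl[OF rtrancl_into_rtrancl[OF Suc arrive] serve2])
  qed simp
  have to_origin: "((x, y, s), (0, 0, Up)) \<in> ?R\<^sup>*" for x y s
    by (rule rtrancl_trans[OF rtrancl_trans[OF to_Up empty2] empty1])
  have from_origin: "((0, 0, Up), (x, y, s)) \<in> ?R\<^sup>*" for x y s
  proof -
    have "((x, y, Up), (x, y, s)) \<in> ?R\<^sup>*" by (cases s) (use fail in auto)
    then show ?thesis by (rule rtrancl_trans[OF rtrancl_trans[OF fill2 fill1]])
  qed
  obtain x y s x' y' s' where "z = (x, y, s)" "z' = (x', y', s')" by (cases z; cases z')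
  then show ?thesis using rtrancl_trans[OF to_origin from_origin] by simp
qed

section \<open>The stationary law of server 1 with Poisson input\<close>

text \<open>The cut equation gives a geometric solution of ratio \<open>lam / p\<close> the Down to
  Up ratio \<open>\<mu> / p - 1\<close>. \<open>lead\<close> mixes the two solutions so that, with
  \<open>up_weight 0 = 1\<close>, the empty Down state is balanced too; it is the coefficient of the
  dominant ratio \<open>gamma1\<close>.\<close>

definition lead :: real where
  "lead = (1 + \<alpha> / (lam + \<beta>) - \<mu> / r') / (\<mu> / r - \<mu> / r')"

definition up_weight :: "nat \<Rightarrow> real" where
  "up_weight x = lead * (lam / r) ^ x + (1 - lead) * (lam / r') ^ x"

definition down_weight :: "nat \<Rightarrow> real" where
  "down_weight x = lead * (\<mu> / r - 1) * (lam / r) ^ x + (1 - lead) * (\<mu> / r' - 1) * (lam / r') ^ x"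

lemma r_r': "r < r'" "r' > 0"
  using r_less r'_greater r_pos by auto

lemma lead_pos: "lead > 0"
proof -
  have "\<mu> / r' < 1" using r'_greater r_r' by simp
  moreover have "\<alpha> / (lam + \<beta>) > 0" using pos by simp
  moreover have "\<mu> / r' < \<mu> / r" using r_r' r_pos pos by (simp add: divide_strict_left_mono)
  ultimately show ?thesis unfolding lead_def by simp
qed

text \<open>Equality of flows across the cut between \<open>x\<close> and \<open>x + 1\<close>:
  arrivals in either status against services while Up. It is used for the invariance of
  \<open>weight\<close> and again in \<open>flux_Suc\<close>.\<close>

lemma up_weight_Suc: "\<mu> * up_weight (Suc x) = lam * (up_weight x + down_weight x)"
  by (simp add: up_weight_def down_weight_def algebra_simps)

lemma down_weight_Suc: "(lam + \<beta>) * down_weight (Suc x) = \<alpha> * up_weight (Suc x) + lam * down_weight x"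
proof -
  have key: "(lam + \<beta>) * ((\<mu> / p - 1) * (lam / p)) = \<alpha> * (lam / p) + lam * (\<mu> / p - 1)"
    if "p > 0" "(lam + \<beta>) * (\<mu> - p) = p * (\<alpha> + \<mu> - p)" for p
  proof -
    have "(lam + \<beta>) * ((\<mu> / p - 1) * (lam / p)) = ((lam + \<beta>) * (\<mu> - p)) * lam / (p * p)"
      using that(1) by (simp add: field_simps)
    also have "\<dots> = (\<alpha> + \<mu> - p) * lam / p"
      unfolding that(2) using that(1) by simp
    also have "\<dots> = \<alpha> * (lam / p) + lam * (\<mu> / p - 1)"
      using that(1) by (simp add: field_simps)
    finally show ?thesis .
  qed
  have "(lam + \<beta>) * down_weight (Suc x) =
      lead * (lam / r) ^ x * ((lam + \<beta>) * ((\<mu> / r - 1) * (lam / r)))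
      + (1 - lead) * (lam / r') ^ x * ((lam + \<beta>) * ((\<mu> / r' - 1) * (lam / r')))"
    unfolding down_weight_def power_Suc by algebra
  also have "\<dots> = \<alpha> * up_weight (Suc x) + lam * down_weight x"
    unfolding key[OF r_pos char_poly(1)] key[OF r_r'(2) char_poly(2)] up_weight_def down_weight_def power_Suc
    by algebra
  finally show ?thesis .
qed

lemma weight_0: "up_weight 0 = 1" "(lam + \<beta>) * down_weight 0 = \<alpha>"
proof -
  show "up_weight 0 = 1" by (simp add: up_weight_def)
  have "\<mu> / r' < \<mu> / r" using r_r' r_pos pos by (simp add: divide_strict_left_mono)
  then have "\<mu> / r - \<mu> / r' \<noteq> 0" by linarith
  then have "lead * (\<mu> / r - \<mu> / r') = 1 + \<alpha> / (lam + \<beta>) - \<mu> / r'"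
    by (rule nonzero_eq_divide_eq[THEN iffD1, OF _ lead_def])
  moreover have "down_weight 0 = lead * (\<mu> / r - \<mu> / r') + \<mu> / r' - 1"
    unfolding down_weight_def power_0 by algebra
  ultimately have "down_weight 0 = \<alpha> / (lam + \<beta>)" by simp
  then show "(lam + \<beta>) * down_weight 0 = \<alpha>" using pos by simp
qed

text \<open>The factor \<open>\<mu> / r' - 1\<close> is negative, so positivity is not visible in
  the closed form; the recursions have only positive terms.\<close>

lemma up_down_weight_pos: "up_weight x > 0 \<and> down_weight x > 0"
proof (induction x)
  case 0
  have "(lam + \<beta>) * down_weight 0 > 0" "lam + \<beta> > 0" using weight_0 pos by simp_all
  then have "down_weight 0 > 0" by (rule zero_less_mult_pos)
  then show ?case using weight_0 by simp
next
  case (Suc x)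
  have "\<mu> * up_weight (Suc x) > 0" unfolding up_weight_Suc using Suc pos by (simp add: add_pos_pos)
  then have "up_weight (Suc x) > 0" using pos by (simp add: zero_less_mult_iff)
  moreover from this have "(lam + \<beta>) * down_weight (Suc x) > 0"
    unfolding down_weight_Suc using Suc pos by (simp add: add_pos_pos)
  ultimately show ?case using pos by (simp add: zero_less_mult_iff)
qed

definition weight :: "state \<Rightarrow> real" where
  "weight z = (case z of (x, y, s) \<Rightarrow> (lam / \<mu>) ^ y * (if s = Up then up_weight x else down_weight x))"

lemma weight_pos: "weight z > 0"
  using up_down_weight_pos pos by (auto simp: weight_def split: prod.split)

lemma weight_invariant: "(\<Sum>\<^sub>\<infinity>z. weight z * generator (rate lam \<mu> \<alpha> \<beta>) z z') = 0"
proof -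
  obtain x y s where z': "z' = (x, y, s)" by (cases z')
  define \<rho> where "\<rho> = lam / \<mu>"
  have \<rho>: "\<mu> * \<rho> = lam" using pos by (simp add: \<rho>_def)
  have shift: "(if y \<ge> 1 then lam * (\<rho> ^ (y - 1) * c) else 0) = (if y \<ge> 1 then \<mu> else 0) * (\<rho> ^ y * c)"
    for c using \<rho> by (cases y) auto
  have shift': "\<mu> * (\<rho> ^ (y + 1) * c) = \<rho> ^ y * (lam * c)" for c
    using \<rho> by (simp flip: \<rho>)
  show ?thesis
  proof (cases s)
    case Up
    have bal: "(if x \<ge> 1 then lam * up_weight (x - 1) else 0) + \<mu> * up_weight (x + 1) + \<beta> * down_weight x
        = (lam + (if x \<ge> 1 then \<mu> else 0) + \<alpha>) * up_weight x"
    proof (cases x)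
      case 0
      then show ?thesis using up_weight_Suc[of 0] weight_0 by (simp add: algebra_simps)
    next
      case (Suc k)
      then show ?thesis using up_weight_Suc[of x] up_weight_Suc[of k] down_weight_Suc[of k]
        by (simp add: algebra_simps)
    qed
    have "(\<Sum>\<^sub>\<infinity>z. weight z * generator (rate lam \<mu> \<alpha> \<beta>) z z') =
      \<rho> ^ y * ((if x \<ge> 1 then lam * up_weight (x - 1) else 0) + \<mu> * up_weight (x + 1) + \<beta> * down_weight x
        - (lam + (if x \<ge> 1 then \<mu> else 0) + \<alpha>) * up_weight x)"
      unfolding z' Up infsum_generator_rate weight_def prod.case \<rho>_def[symmetric] shift shift'
      by (simp add: shift shift' algebra_simps)
    then show ?thesis using bal by simp
  next
    case Down
    have bal: "(if x \<ge> 1 then lam * down_weight (x - 1) else 0) + \<alpha> * up_weight x = (lam + \<beta>) * down_weight x"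
    proof (cases x)
      case 0
      then show ?thesis using weight_0 by simp
    next
      case (Suc k)
      then show ?thesis using down_weight_Suc[of k] by simp
    qed
    have "(\<Sum>\<^sub>\<infinity>z. weight z * generator (rate lam \<mu> \<alpha> \<beta>) z z') =
      \<rho> ^ y * ((if x \<ge> 1 then lam * down_weight (x - 1) else 0) + \<alpha> * up_weight x - (lam + \<beta>) * down_weight x)"
      unfolding z' Down infsum_generator_rate weight_def prod.case \<rho>_def[symmetric] shift shift'
      by (simp add: shift shift' algebra_simps)
    then show ?thesis using bal by simp
  qed
qed

text \<open>Comparison with the mass function of a product of two geometric laws and the uniform law
  on the statuses, the source of the factor 1/2 in \<open>k\<close>.\<close>

lemma weight_summable: "weight summable_on UNIV"
proof -
  define p where "p = pair_pmf (geometric_pmf (1 - lam / r)) (pair_pmf (geometric_pmf (1 - lam / \<mu>)) (pmf_of_set {Up, Down}))"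
  define k where "k = (1 - lam / r) * (1 - lam / \<mu>) / 2"
  define M where "M = (\<bar>lead\<bar> + \<bar>1 - lead\<bar>) * (1 + \<bar>\<mu> / r - 1\<bar> + \<bar>\<mu> / r' - 1\<bar>)"
  have q: "0 < lam / r" "lam / r < 1" "0 < lam / \<mu>" "lam / \<mu> < 1" "0 < lam / r'" "lam / r' \<le> lam / r"
    using pos r_pos lam_less r_less r_r' by (auto intro!: divide_left_mono)
  have pmf_p: "pmf p (x, y, s) = k * ((lam / r) ^ x * (lam / \<mu>) ^ y)" for x y s
    using q by (cases s) (simp_all add: p_def pmf_pair k_def)
  have k: "k > 0" using q by (simp add: k_def)
  have geo: "\<bar>a * (lam / r) ^ x + b * (lam / r') ^ x\<bar> \<le> (\<bar>a\<bar> + \<bar>b\<bar>) * (lam / r) ^ x" for a b x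
  proof -
    have "\<bar>a * (lam / r) ^ x + b * (lam / r') ^ x\<bar> \<le> \<bar>a\<bar> * (lam / r) ^ x + \<bar>b\<bar> * (lam / r') ^ x"
      using q by (intro order_trans[OF abs_triangle_ineq]) (simp add: abs_mult)
    also have "\<dots> \<le> \<bar>a\<bar> * (lam / r) ^ x + \<bar>b\<bar> * (lam / r) ^ x"
      using q by (intro add_left_mono mult_left_mono power_mono) auto
    finally show ?thesis by (simp add: algebra_simps)
  qed
  have "a + b \<le> (a + b) * (1 + c + d)" "a * c + b * d \<le> (a + b) * (1 + c + d)"
    if "a \<ge> 0" "b \<ge> 0" "c \<ge> 0" "d \<ge> 0" for a b c d :: real
    using that by (simp_all add: distrib_left distrib_right add_nonneg_nonneg)
  then have "\<bar>lead\<bar> + \<bar>1 - lead\<bar> \<le> M" "\<bar>lead * (\<mu> / r - 1)\<bar> + \<bar>(1 - lead) * (\<mu> / r' - 1)\<bar> \<le> M"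
    unfolding M_def abs_mult by simp_all
  then have "\<bar>up_weight x\<bar> \<le> M * (lam / r) ^ x" "\<bar>down_weight x\<bar> \<le> M * (lam / r) ^ x" for x
    unfolding up_weight_def down_weight_def
    using q by (intro order_trans[OF geo] mult_right_mono; simp)+
  then have bound: "norm (weight z) \<le> norm (M / k * pmf p z)" for z
    using q k M_def by (cases z) (auto simp: weight_def pmf_p abs_mult mult.commute mult.left_commute intro!: mult_left_mono)
  have "(\<lambda>z. norm (M / k * pmf p z)) summable_on UNIV"
    using summable_on_cmult_right[of "pmf p" UNIV "\<bar>M / k\<bar>"] pmf_has_sum_1[of p]
    by (auto simp: abs_mult summable_on_def)
  then have "(\<lambda>z. norm (weight z)) summable_on UNIV"
    using bound by (rule Infinite_Sum.abs_summable_on_comparison_test)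
  then show ?thesis by (rule abs_summable_summable)
qed

lemma product_form:
  assumes "stationary_distribution (rate lam \<mu> \<alpha> \<beta>) \<pi>"
  obtains N where "N > 0" "\<And>z. pmf \<pi> z = N * weight z"
proof
  define Z where "Z = (\<Sum>\<^sub>\<infinity>z. weight z)"
  have "Z > 0"
    using nonneg_infsum_le_0D[OF _ weight_summable] weight_pos unfolding Z_def
    by (metis UNIV_I less_irrefl less_imp_le not_less)
  then show "1 / Z > 0" by simp
  define \<delta> where "\<delta> z = pmf \<pi> z + (- 1 / Z) * weight z" for z
  have \<delta>: "(\<delta> has_sum (1 + (- 1 / Z) * Z)) UNIV"
    unfolding \<delta>_def Z_def
    by (intro has_sum_add pmf_has_sum_1 has_sum_cmult_right has_sum_infsum weight_summable)
  have gen: "(\<Sum>\<^sub>\<infinity>z. f z * generator (rate lam \<mu> \<alpha> \<beta>) z z') = 0 \<Longrightarrow>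
      (\<Sum>\<^sub>\<infinity>z. g z * generator (rate lam \<mu> \<alpha> \<beta>) z z') = 0 \<Longrightarrow>
      (\<Sum>\<^sub>\<infinity>z. (f z + c * g z) * generator (rate lam \<mu> \<alpha> \<beta>) z z') = 0" for f g :: "state \<Rightarrow> real" and c z'
  proof -
    obtain x y s where z': "z' = (x, y, s)" by (cases z')
    assume f: "(\<Sum>\<^sub>\<infinity>z. f z * generator (rate lam \<mu> \<alpha> \<beta>) z z') = 0"
      and g: "(\<Sum>\<^sub>\<infinity>z. g z * generator (rate lam \<mu> \<alpha> \<beta>) z z') = 0"
    have "(\<Sum>\<^sub>\<infinity>z. (f z + c * g z) * generator (rate lam \<mu> \<alpha> \<beta>) z z') =
       (\<Sum>\<^sub>\<infinity>z. f z * generator (rate lam \<mu> \<alpha> \<beta>) z z') + c * (\<Sum>\<^sub>\<infinity>z. g z * generator (rate lam \<mu> \<alpha> \<beta>) z z')"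
    proof (cases s)
      case Up
      show ?thesis unfolding z' Up infsum_generator_rate by (simp add: algebra_simps)
    next
      case Down
      show ?thesis unfolding z' Down infsum_generator_rate by (simp add: algebra_simps)
    qed
    then show ?thesis unfolding f g by simp
  qed
  have "\<delta> z = 0" for z
  proof (rule invariant_signed_measure_eq_0[where q="rate lam \<mu> \<alpha> \<beta>" and c="lam + 2 * \<mu> + \<alpha> + \<beta>" and \<delta>=\<delta>])
    show "rate lam \<mu> \<alpha> \<beta> z z' \<ge> 0" for z z'
      using pos by (cases z; cases z') auto
    show "rate lam \<mu> \<alpha> \<beta> z summable_on -{z}" for z
      using has_sum_rate by (cases z) (auto simp: summable_on_def)
    show "(\<Sum>\<^sub>\<infinity>w\<in>-{z}. rate lam \<mu> \<alpha> \<beta> z w) \<le> lam + 2 * \<mu> + \<alpha> + \<beta>" for z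
      using pos by (cases z) (simp add: infsumI[OF has_sum_rate])
    show "\<delta> summable_on UNIV" using \<delta> by (auto simp: summable_on_def)
    show "(\<Sum>\<^sub>\<infinity>z. \<delta> z) = 0" using infsumI[OF \<delta>] \<open>Z > 0\<close> by simp
    show "(\<Sum>\<^sub>\<infinity>z. \<delta> z * generator (rate lam \<mu> \<alpha> \<beta>) z z') = 0" for z'
      unfolding \<delta>_def 
      by (rule gen[OF assms[unfolded stationary_distribution_def, rule_format] weight_invariant])
  qed (rule irreducible)
  then show "pmf \<pi> z = 1 / Z * weight z" for z by (simp add: \<delta>_def)
qed

section \<open>The twisted free process\<close>

abbreviation h :: "free_state \<Rightarrow> real" where "h \<equiv> twist_h lam \<mu> \<alpha> \<beta>"
abbreviation twisted :: "free_state \<Rightarrow> free_state pmf" where "twisted \<equiv> twisted_kernel C lam \<mu> \<alpha> \<beta>"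

text \<open>Kept free of \<open>C\<close>: the free kernel maps \<open>f\<close> to
  \<open>f + free_generator f / C\<close>, so being harmonic or superharmonic does not involve the
  uniformization.\<close>

definition free_generator :: "(free_state \<Rightarrow> real) \<Rightarrow> free_state \<Rightarrow> real" where
  "free_generator f z = (case z of (m, y, s) \<Rightarrow>
     lam * (f (m, y + 1, s) - f (m, y, s))
     + (if y \<ge> 1 then \<mu> * (f (m + 1, y - 1, s) - f (m, y, s)) else 0)
     + (if s = Up then \<mu> * (f (m - 1, y, Up) - f (m, y, Up)) + \<alpha> * (f (m, y, Down) - f (m, y, Up))
        else \<beta> * (f (m, y, Up) - f (m, y, Down))))"

lemmas h_pos = twist_h_pos[OF pos uniformization]

text \<open>Doob's transform: the twisted expectation of \<open>g\<close> is the free expectation of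
  \<open>h * g\<close>, divided by \<open>h z\<close>. One step reaches finitely many states, whence
  integrability of every \<open>g\<close>.\<close>

lemma
  shows integrable_twisted: "integrable (measure_pmf (twisted z)) g"
    and expectation_twisted:
      "h z * (\<integral>z'. g z' \<partial>measure_pmf (twisted z)) = h z * g z + free_generator (\<lambda>w. h w * g w) z / C"
proof -
  obtain m y s where z: "z = (m, y, s)" by (cases z)
  define F where "F w = h w * g w" for w
  define A where "A = {(m, y, s), (m, y + 1, s), (m, y, if s = Up then Down else Up)}
     \<union> (if y \<ge> 1 then {(m + 1, y - 1, s)} else {}) \<union> (if s = Up then {(m - 1, y, Up)} else {})"
  have fin: "finite A" by (simp add: A_def)
  define k where "k = free_kernel C lam \<mu> \<alpha> \<beta>"
  have off: "k z w = free_jump C lam \<mu> \<alpha> \<beta> z w" if "w \<noteq> z" for w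
    using that by (simp add: k_def free_kernel_def)
  have diag: "k (m, y, s) (m, y, s) = 1 - (lam + (if y \<ge> 1 then \<mu> else 0) + (if s = Up then \<mu> + \<alpha> else \<beta>)) / C"
    using infsum_free_jump[OF pos uniformization]
    by (cases s) (simp_all add: k_def free_kernel_def add.assoc)
  have pmf: "pmf (twisted z) w = k z w * h w / h z" for w
    unfolding k_def by (rule pmf_twisted_kernel[OF pos uniformization])
  have supp: "w \<in> A" if "k z w \<noteq> 0" for w
  proof (cases "w = z")
    case True
    then show ?thesis by (simp add: A_def z)
  next
    case False
    obtain m' y' s' where w: "w = (m', y', s')" by (cases w)
    have "free_jump C lam \<mu> \<alpha> \<beta> (m, y, s) (m', y', s') \<noteq> 0" using that off[OF False] z w by simp
    then show ?thesis unfolding w by (auto simp: A_def split: if_splits)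
  qed
  have "set_pmf (twisted z) \<subseteq> A"
    using supp by (auto simp: set_pmf_iff pmf)
  then show "integrable (measure_pmf (twisted z)) g"
    using fin by (intro integrable_measure_pmf_finite) (rule finite_subset)
  have "(\<integral>z'. g z' \<partial>measure_pmf (twisted z)) = (\<Sum>w\<in>A. g w * pmf (twisted z) w)"
    using supp by (intro integral_measure_pmf_real fin) (auto simp: set_pmf_iff pmf)
  also have "\<dots> = (\<Sum>w\<in>A. F w * k z w) / h z"
    by (simp add: pmf F_def sum_divide_distrib mult_ac)
  finally have "h z * (\<integral>z'. g z' \<partial>measure_pmf (twisted z)) = (\<Sum>w\<in>A. F w * k z w)"
    using h_pos[of z] by simp
  also have "(\<Sum>w\<in>A. F w * k z w) = F z + free_generator F z / C"
  proof (cases s)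
    case Up
    have sum: "(\<Sum>w\<in>A. F w * k z w) = F z * k z z + F (m, y + 1, Up) * k z (m, y + 1, Up) + F (m, y, Down) * k z (m, y, Down)
        + (if y \<ge> 1 then F (m + 1, y - 1, Up) * k z (m + 1, y - 1, Up) else 0) + F (m - 1, y, Up) * k z (m - 1, y, Up)"
      using Up z by (simp add: A_def)
    have v: "k z (m, y + 1, Up) = lam / C" "k z (m, y, Down) = \<alpha> / C" "k z (m - 1, y, Up) = \<mu> / C"
      "y \<ge> 1 \<Longrightarrow> k z (m + 1, y - 1, Up) = \<mu> / C"
      using Up z by (subst off; simp)+
    have d: "k z z = 1 - (lam + (if y \<ge> 1 then \<mu> else 0) + (\<mu> + \<alpha>)) / C"
      using diag Up z by simp
    have up: "(if y \<ge> 1 then F (m + 1, y - 1, Up) * k z (m + 1, y - 1, Up) else 0) =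
        (if y \<ge> 1 then F (m + 1, y - 1, Up) * (\<mu> / C) else 0)"
      using v by simp
    show ?thesis
      unfolding sum up v(1-3) d unfolding z free_generator_def prod.case Up
      using C_pos by (simp add: field_simps)
  next
    case Down
    have sum: "(\<Sum>w\<in>A. F w * k z w) = F z * k z z + F (m, y + 1, Down) * k z (m, y + 1, Down) + F (m, y, Up) * k z (m, y, Up)
        + (if y \<ge> 1 then F (m + 1, y - 1, Down) * k z (m + 1, y - 1, Down) else 0)"
      using Down z by (simp add: A_def)
    have v: "k z (m, y + 1, Down) = lam / C" "k z (m, y, Up) = \<beta> / C"
      "y \<ge> 1 \<Longrightarrow> k z (m + 1, y - 1, Down) = \<mu> / C"
      using Down z by (subst off; simp)+
    have d: "k z z = 1 - (lam + (if y \<ge> 1 then \<mu> else 0) + \<beta>) / C"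
      using diag Down z by simp
    have up: "(if y \<ge> 1 then F (m + 1, y - 1, Down) * k z (m + 1, y - 1, Down) else 0) =
        (if y \<ge> 1 then F (m + 1, y - 1, Down) * (\<mu> / C) else 0)"
      using v by simp
    show ?thesis
      unfolding sum up v(1-2) d unfolding z free_generator_def prod.case Down
      using C_pos by (simp add: field_simps)
  qed
  finally show "h z * (\<integral>z'. g z' \<partial>measure_pmf (twisted z)) = h z * g z + free_generator (\<lambda>w. h w * g w) z / C"
    by (simp add: F_def[abs_def])
qed

abbreviation H :: "free_state \<Rightarrow> real" where "H \<equiv> H_twisted C lam \<mu> \<alpha> \<beta>"

lemma H_eq: "H z = survival_forever twisted {z. fst z > 0} z"
  by (simp add: H_twisted_def survival_forever_def)

lemma H_bounds: "0 \<le> H z" "H z \<le> 1"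
  unfolding H_eq by (rule survival_forever_bounds)+

definition F :: "free_state \<Rightarrow> real" where
  "F z = (if fst z > 0 then h z * H z else 0)"

text \<open>Multiplying the first-step equation of \<open>H\<close> by \<open>h\<close> undoes the
  twist, and the indicator of survival becomes the killing in \<open>F\<close>. The equation also
  holds where \<open>F\<close> vanishes, which gives \<open>h_H_boundary\<close>.\<close>

lemma h_H: "h z * H z = F z + free_generator F z / C"
proof -
  have "F = (\<lambda>w. h w * (indicator {z. fst z > 0} w * H w))"
    by (auto simp: F_def fun_eq_iff)
  then show ?thesis
    using expectation_twisted[of z "\<lambda>w. indicator {z. fst z > 0} w * H w"]
      survival_forever_first_step[of twisted "{z. fst z > 0}" z]
    by (simp add: H_eq)
qed

lemma F_harmonic: "free_generator F z = 0" if "fst z > 0"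
  using h_H[of z] C_pos that by (simp add: F_def)

text \<open>From level 0 a positive level is reached only by a departure from server 2, so an empty
  server 2 contributes nothing.\<close>

lemma h_H_boundary: "h (0, y, s) * H (0, y, s) = (if y \<ge> 1 then \<mu> / C * F (1, y - 1, s) else 0)"
  using h_H[of "(0, y, s)"] by (simp add: F_def free_generator_def)

section \<open>A superharmonic barrier for the free process\<close>

text \<open>\<open>b\<^sup>2\<close> is the inverse of \<open>gamma1\<close>, so that
  \<open>sqrt (h (m, y, s)) = b powi (m + int y) * e s\<close>.\<close>

definition b :: real where "b = sqrt (r / lam)"
definition \<kappa> :: real where "\<kappa> = (b - 1) / (b + 1)"
definition e :: "status \<Rightarrow> real" where "e s = (if s = Up then 1 else sqrt (\<beta> / t))"

lemma b_sq: "b\<^sup>2 = r / lam" and b_greater: "b > 1" and \<kappa>_pos: "\<kappa> > 0" and e_pos: "e s > 0"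
proof -
  show "b\<^sup>2 = r / lam" using r_pos pos by (simp add: b_def)
  show "b > 1" using lam_less pos by (simp add: b_def)
  then show "\<kappa> > 0" by (simp add: \<kappa>_def)
  show "e s > 0" using pos t_pos by (simp add: e_def)
qed

text \<open>By the arithmetic-geometric mean inequality \<open>sqrt h\<close>, the first summand of the barrier, is strictly
  superharmonic, but it is not comparable with \<open>h\<close> where \<open>m \<le> 0\<close> and \<open>y\<close> is large. The second summand
  is comparable there; its generator is positive only at \<open>y = 0\<close>, and \<open>\<kappa>\<close> is the value at which the slack
  of the first summand exactly pays for that.\<close>

definition barrier :: "free_state \<Rightarrow> real" where
  "barrier z = (case z of (m, y, s) \<Rightarrow> (b powi (m + int y) + \<kappa> * b powi (m + 2 * int y)) * e s)"

lemma h_b: "h (m, y, s) = b powi (2 * (m + int y)) * (e s)\<^sup>2"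
proof -
  have "(lam / r) powi (- (m + int y)) = (b\<^sup>2) powi (m + int y)"
    unfolding b_sq by (simp only: power_int_minus power_int_inverse[symmetric] inverse_divide)
  also have "\<dots> = b powi (2 * (m + int y))"
    by (simp only: power_int_mult power_int_numeral)
  finally show ?thesis
    using pos t_pos by (simp add: twist_h_eq e_def)
qed

lemma free_generator_barrier: "free_generator barrier z \<le> 0"
proof -
  obtain m y s where z: "z = (m, y, s)" by (cases z)
  define P where "P = b powi (m + int y)"
  define Q where "Q = b powi (m + 2 * int y)"
  define k where "k = e Down"
  have b0: "b > 0" using b_greater by simp
  have PQ: "P > 0" "Q > 0" using b0 by (simp_all add: P_def Q_def)
  have k0: "k > 0" using e_pos by (simp add: k_def)
  have shift: "b powi (m + int (y + 1)) = P * b" "b powi (m + 2 * int (y + 1)) = Q * b\<^sup>2"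
    "b powi (m - 1 + int y) = P / b" "b powi (m - 1 + 2 * int y) = Q / b"
    using b0 by (simp_all add: P_def Q_def power_int_add power_int_diff algebra_simps power2_eq_square)
  have shift': "b powi (m + 1 + int (y - 1)) = P" "b powi (m + 1 + 2 * int (y - 1)) = Q / b" if "y \<ge> 1"
    using b0 that by (simp_all add: P_def Q_def of_nat_diff power_int_add power_int_diff algebra_simps power2_eq_square)
  have bar: "barrier (m, y, s') = (P + \<kappa> * Q) * e s'" "barrier (m, y + 1, s') = (P * b + \<kappa> * (Q * b\<^sup>2)) * e s'"
    "barrier (m - 1, y, s') = (P / b + \<kappa> * (Q / b)) * e s'" for s'
    unfolding barrier_def prod.case shift by (simp_all add: P_def Q_def)
  have dep: "(if y \<ge> 1 then \<mu> * (barrier (m + 1, y - 1, s') - barrier (m, y, s')) else 0) =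
      \<kappa> * Q * (if y \<ge> 1 then \<mu> * (1 / b - 1) else 0) * e s'" for s'
  proof (cases "y \<ge> 1")
    case True
    then have "barrier (m + 1, y - 1, s') = (P + \<kappa> * (Q / b)) * e s'"
      unfolding barrier_def prod.case by (simp only: shift')
    then show ?thesis using True by (simp add: bar(1) algebra_simps)
  qed simp
  have lb: "lam * b\<^sup>2 = r" using b_sq pos by simp
  have harm: "lam * b\<^sup>2 + \<mu> / b\<^sup>2 + \<alpha> * k\<^sup>2 = lam + \<mu> + \<alpha>" "lam * b\<^sup>2 + \<beta> / k\<^sup>2 = lam + \<beta>"
  proof -
    have "k\<^sup>2 = \<beta> / t" using pos t_pos by (simp add: k_def e_def)
    moreover have "2 * \<beta> / (lam + \<beta> - \<mu> - \<alpha> + sqrt (s1 lam \<mu> \<alpha> \<beta>)) = \<beta> / t"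
      by (simp add: t_def)
    ultimately show "lam * b\<^sup>2 + \<mu> / b\<^sup>2 + \<alpha> * k\<^sup>2 = lam + \<mu> + \<alpha>" "lam * b\<^sup>2 + \<beta> / k\<^sup>2 = lam + \<beta>"
      using twist_h_harmonic[OF pos uniformization] pos by (simp_all add: gamma1_eq b_sq)
  qed
  have amgm: "2 * (x - 1) \<le> x\<^sup>2 - 1" for x :: real
    using zero_le_power2[of "x - 1"] by (simp add: power2_eq_square algebra_simps)
  \<comment> \<open>\<open>S\<close> is the relative contribution of server 1 and of the status
    changes, common to both summands. The assumed bound will follow from \<open>amgm\<close> and the
    harmonicity of \<open>h\<close>. A departure from server 2 fixes \<open>m + y\<close> and so
    does not affect the first summand.\<close>
  have core: "P * (lam * (b - 1) + S) + \<kappa> * Q * (lam * (b\<^sup>2 - 1) + (if y \<ge> 1 then \<mu> * (1 / b - 1) else 0) + S) \<le> 0"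
    if S: "2 * S \<le> - lam * (b\<^sup>2 - 1)" for S
  proof -
    have 1: "lam * (b - 1) + S \<le> - (lam / 2) * (b - 1)\<^sup>2"
      using S by (simp add: power2_eq_square algebra_simps)
    show ?thesis
    proof (cases "y \<ge> 1")
      case True
      \<comment> \<open>With server 2 busy, departures shrink the second summand by the factor
        \<open>1 / b\<close>, and they outweigh the arrivals because
        \<open>lam * b\<^sup>2 = r < \<mu>\<close>.\<close>
      have "lam * (b\<^sup>2 - 1) + \<mu> * (1 / b - 1) + S \<le> lam / 2 * (b\<^sup>2 - 1) + \<mu> * (1 / b - 1)"
        using S by (simp add: algebra_simps)
      also have "\<dots> = (b - 1) / b * (lam * (b * (b + 1) / 2) - \<mu>)"
        using b0 by (simp add: field_simps power2_eq_square)
      also have "\<dots> \<le> 0"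
      proof (rule mult_nonneg_nonpos)
        have "b * (b + 1) / 2 \<le> b\<^sup>2" using b_greater by (simp add: power2_eq_square)
        then have "lam * (b * (b + 1) / 2) \<le> r" unfolding lb[symmetric] using pos by simp
        then show "lam * (b * (b + 1) / 2) - \<mu> \<le> 0" using r_less by simp
      qed (use b_greater in simp)
      finally have 2: "lam * (b\<^sup>2 - 1) + \<mu> * (1 / b - 1) + S \<le> 0" .
      have "- (lam / 2) * (b - 1)\<^sup>2 \<le> 0" using pos by simp
      with 1 have "lam * (b - 1) + S \<le> 0" by linarith
      then have "P * (lam * (b - 1) + S) \<le> 0" "\<kappa> * Q * (lam * (b\<^sup>2 - 1) + \<mu> * (1 / b - 1) + S) \<le> 0"
        using 2 PQ \<kappa>_pos by (simp_all add: mult_nonneg_nonpos)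
      then show ?thesis using True by simp
    next
      case False
      then have "y = 0" by simp
      then have "P = Q" by (simp add: P_def Q_def)
      have "\<kappa> * (lam * (b\<^sup>2 - 1) + S) \<le> \<kappa> * (lam / 2 * (b\<^sup>2 - 1))"
        using S \<kappa>_pos by (intro mult_left_mono) (simp_all add: algebra_simps)
      also have "\<dots> = lam / 2 * (b - 1)\<^sup>2"
      proof -
        have "\<kappa> * (b + 1) = b - 1" using b_greater by (simp add: \<kappa>_def)
        then show ?thesis by (simp add: power2_eq_square) algebra
      qed
      finally have "(lam * (b - 1) + S) + \<kappa> * (lam * (b\<^sup>2 - 1) + S) \<le> 0"
        using 1 by linarith
      then have "P * ((lam * (b - 1) + S) + \<kappa> * (lam * (b\<^sup>2 - 1) + S)) \<le> 0"
        using PQ by (simp add: mult_nonneg_nonpos)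
      then show ?thesis using False \<open>P = Q\<close> by (simp add: algebra_simps)
    qed
  qed
  show ?thesis
  proof (cases s)
    case Up
    define S where "S = \<mu> * (1 / b - 1) + \<alpha> * (k - 1)"
    have "2 * S = \<mu> * (2 * (1 / b - 1)) + \<alpha> * (2 * (k - 1))" by (simp add: S_def algebra_simps)
    also have "\<dots> \<le> \<mu> * ((1 / b)\<^sup>2 - 1) + \<alpha> * (k\<^sup>2 - 1)"
      using pos by (intro add_mono mult_left_mono amgm) auto
    also have "\<dots> = - lam * (b\<^sup>2 - 1)"
      using harm(1) by (simp add: power_divide algebra_simps)
    finally have S: "2 * S \<le> - lam * (b\<^sup>2 - 1)" .
    have "free_generator barrier z = P * (lam * (b - 1) + S) + \<kappa> * Q * (lam * (b\<^sup>2 - 1) + (if y \<ge> 1 then \<mu> * (1 / b - 1) else 0) + S)"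
      unfolding z Up free_generator_def prod.case dep unfolding bar
      by (simp add: e_def[of Up] k_def[symmetric] S_def algebra_simps)
    with core[OF S] show ?thesis by simp
  next
    case Down
    define S where "S = \<beta> * (1 / k - 1)"
    have "2 * S = \<beta> * (2 * (1 / k - 1))" by (simp add: S_def algebra_simps)
    also have "\<dots> \<le> \<beta> * ((1 / k)\<^sup>2 - 1)"
      using pos by (intro mult_left_mono amgm) auto
    also have "\<dots> = - lam * (b\<^sup>2 - 1)"
      using harm(2) by (simp add: power_divide algebra_simps)
    finally have S: "2 * S \<le> - lam * (b\<^sup>2 - 1)" .
    have "free_generator barrier z = k * (P * (lam * (b - 1) + S) + \<kappa> * Q * (lam * (b\<^sup>2 - 1) + (if y \<ge> 1 then \<mu> * (1 / b - 1) else 0) + S))"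
      unfolding z Down free_generator_def prod.case dep unfolding bar
      using k0 by (simp add: e_def[of Up] k_def[symmetric] S_def algebra_simps)
    with core[OF S] k0 show ?thesis by (simp add: mult_nonneg_nonpos)
  qed
qed

text \<open>\<open>e\<close> enters \<open>h\<close> squared but the barrier only to the first
  power; the minimum compensates for this in both statuses.\<close>

definition \<epsilon> :: real where "\<epsilon> = \<kappa> * min 1 (1 / e Down)"

lemma \<epsilon>_pos: "\<epsilon> > 0"
  using \<kappa>_pos e_pos[of Down] by (simp add: \<epsilon>_def)

text \<open>The second summand suffices: for \<open>m \<le> 0\<close> the exponent
  \<open>2 * (m + y)\<close> of \<open>h\<close> is at most \<open>m + 2 * y\<close>.\<close>

lemma h_le_barrier: "\<epsilon> * h z \<le> barrier z" if "fst z \<le> 0"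
proof -
  obtain m y s where z: "z = (m, y, s)" by (cases z)
  have b0: "b > 0" using b_greater by simp
  have m: "m \<le> 0" using that z by simp
  have "\<epsilon> * (e s)\<^sup>2 \<le> \<kappa> * e s"
  proof (cases s)
    case Up
    then show ?thesis using \<kappa>_pos by (simp add: e_def \<epsilon>_def)
  next
    case Down
    have "\<epsilon> \<le> \<kappa> * (1 / e s)" unfolding \<epsilon>_def Down using \<kappa>_pos by (intro mult_left_mono) auto
    then have "\<epsilon> * (e s)\<^sup>2 \<le> \<kappa> * (1 / e s) * (e s)\<^sup>2" by (intro mult_right_mono) auto
    then show ?thesis using e_pos[of s] by (simp add: power2_eq_square)
  qed
  moreover have "b powi (2 * (m + int y)) \<le> b powi (m + 2 * int y)"
    using m b_greater by (intro power_int_increasing) auto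
  ultimately have "\<epsilon> * (e s)\<^sup>2 * b powi (2 * (m + int y)) \<le> \<kappa> * e s * b powi (m + 2 * int y)"
    by (rule mult_mono) (use b0 \<kappa>_pos e_pos[of s] in auto)
  also have "\<dots> \<le> barrier z"
    using b0 e_pos[of s] by (simp add: z barrier_def algebra_simps)
  finally show ?thesis by (simp add: z h_b algebra_simps)
qed

text \<open>Division by \<open>\<epsilon> * h\<close> turns the barrier into a superharmonic
  function of the twisted chain that is at least 1 on the levels \<open>m \<le> 0\<close>, as
  \<open>survival_forever_ge\<close> requires.\<close>

lemma H_ge: "h z - barrier z / \<epsilon> \<le> h z * H z"
proof -
  define V where "V z = barrier z / \<epsilon> / h z" for z
  have hV: "h w * V w = barrier w / \<epsilon>" for w using h_pos[of w] by (simp add: V_def)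
  have "H z \<ge> 1 - V z"
    unfolding H_eq
  proof (rule survival_forever_ge)
    show "V z \<ge> 0" for z
      using h_pos[of z] \<epsilon>_pos \<kappa>_pos e_pos b_greater
      by (cases z) (auto simp: V_def barrier_def less_imp_le intro!: divide_nonneg_nonneg mult_nonneg_nonneg add_nonneg_nonneg)
    show "V z \<ge> 1" if "z \<notin> {z. fst z > 0}" for z
      using h_le_barrier[of z] that h_pos[of z] \<epsilon>_pos by (simp add: V_def field_simps)
    show "integrable (measure_pmf (twisted z)) V" for z by (rule integrable_twisted)
    show "(\<integral>z'. V z' \<partial>measure_pmf (twisted z)) \<le> V z" for z
    proof -
      have "free_generator (\<lambda>w. h w * V w) z = free_generator barrier z / \<epsilon>"
        unfolding hV by (cases z) (simp add: free_generator_def diff_divide_distrib add_divide_distrib right_diff_distrib)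
      also have "\<dots> \<le> 0" using free_generator_barrier \<epsilon>_pos by (simp add: divide_nonpos_pos)
      finally have "free_generator (\<lambda>w. h w * V w) z / C \<le> 0" using C_pos by (simp add: divide_nonpos_pos)
      then have "h z * (\<integral>z'. V z' \<partial>measure_pmf (twisted z)) \<le> h z * V z"
        unfolding expectation_twisted by simp
      then show ?thesis using h_pos[of z] by (rule mult_left_le_imp_le)
    qed
  qed
  then have "h z * (1 - V z) \<le> h z * H z" using h_pos[of z] by simp
  then show ?thesis by (simp add: right_diff_distrib hV)
qed

section \<open>The level sums\<close>

abbreviation \<rho> :: real where "\<rho> \<equiv> lam / \<mu>"
abbreviation \<sigma> :: real where "\<sigma> \<equiv> r / \<mu>"

definition \<Phi> :: "nat \<Rightarrow> status \<Rightarrow> real" where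
  "\<Phi> n s = (\<Sum>y. \<rho> ^ y * F (int n, y, s))"

lemma \<sigma>_bounds: "0 < \<sigma>" "\<sigma> < 1"
  using r_pos r_less pos by simp_all

lemma \<rho>_b: "\<rho> * b\<^sup>2 = \<sigma>" "0 < \<rho> * b" "\<rho> * b < 1"
proof -
  show 1: "\<rho> * b\<^sup>2 = \<sigma>" using pos by (simp add: b_sq)
  show "0 < \<rho> * b" using pos b_greater by simp
  have "\<rho> * b \<le> \<rho> * b\<^sup>2"
    using pos b_greater by (intro mult_left_mono) (simp_all add: power2_eq_square)
  also note 1
  also note \<sigma>_bounds(2)
  finally show "\<rho> * b < 1" .
qed

text \<open>The decay of the geometric weight and the growth of \<open>h\<close> combine to the
  ratio \<open>\<sigma>\<close>, which is below 1. Its geometric series is the source of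
  \<open>B_const = 1 - \<sigma>\<close>.\<close>

lemma level_h: "\<rho> ^ y * h (int n, y, s) = (b\<^sup>2) ^ n * (e s)\<^sup>2 * \<sigma> ^ y"
proof -
  have "h (int n, y, s) = (b\<^sup>2) ^ n * (b\<^sup>2) ^ y * (e s)\<^sup>2"
  proof -
    have "2 * (int n + int y) = int (2 * n + 2 * y)" by simp
    then have "b powi (2 * (int n + int y)) = b ^ (2 * n + 2 * y)" by (simp only: power_int_of_nat)
    then show ?thesis unfolding h_b by (simp add: power_add power_mult)
  qed
  then show ?thesis unfolding \<rho>_b(1)[symmetric] power_mult_distrib by simp
qed

lemma level_barrier:
  "\<rho> ^ y * barrier (int n, y, s) = b ^ n * e s * ((\<rho> * b) ^ y + \<kappa> * \<sigma> ^ y)"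
proof -
  have "int n + int y = int (n + y)" "int n + 2 * int y = int (n + 2 * y)" by simp_all
  then have "b powi (int n + int y) = b ^ (n + y)" "b powi (int n + 2 * int y) = b ^ (n + 2 * y)"
    by (simp_all only: power_int_of_nat)
  then have "barrier (int n, y, s) = b ^ n * e s * (b ^ y + \<kappa> * (b\<^sup>2) ^ y)"
    by (simp add: barrier_def power_add power_mult power2_eq_square power_mult_distrib algebra_simps)
  then show ?thesis
    unfolding \<rho>_b(1)[symmetric] power_mult_distrib by (simp add: algebra_simps)
qed

lemma level_h_sums: "(\<lambda>y. \<rho> ^ y * h (int n, y, s)) sums ((b\<^sup>2) ^ n * (e s)\<^sup>2 * (1 / (1 - \<sigma>)))"
  unfolding level_h using \<sigma>_bounds by (intro sums_mult geometric_sums) simp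

lemma level_barrier_sums:
  "(\<lambda>y. \<rho> ^ y * barrier (int n, y, s)) sums (b ^ n * e s * (1 / (1 - \<rho> * b) + \<kappa> * (1 / (1 - \<sigma>))))"
  unfolding level_barrier using \<sigma>_bounds \<rho>_b by (intro sums_mult sums_add geometric_sums) simp_all

lemma F_bounds: "0 \<le> F z" "F z \<le> h z"
  using H_bounds[of z] h_pos[of z] by (auto simp: F_def mult_left_le)

lemma F_level_bounds: "0 \<le> \<rho> ^ y * F z" "\<rho> ^ y * F z \<le> \<rho> ^ y * h z"
  using F_bounds[of z] pos by (simp_all add: mult_left_mono)

lemma \<Phi>_sums: "(\<lambda>y. \<rho> ^ y * F (int n, y, s)) sums \<Phi> n s"
  unfolding \<Phi>_def
proof (rule summable_sums, rule summable_comparison_test')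
  show "summable (\<lambda>y. \<rho> ^ y * h (int n, y, s))" using level_h_sums by (rule sums_summable)
  show "norm (\<rho> ^ y * F (int n, y, s)) \<le> \<rho> ^ y * h (int n, y, s)" if "y \<ge> 0" for y
    using F_level_bounds[of y "(int n, y, s)"] by simp
qed

lemma \<Phi>_0: "\<Phi> 0 s = 0"
  by (simp add: \<Phi>_def F_def)

text \<open>\<open>F\<close> lies between \<open>h\<close> minus a multiple of the barrier and
  \<open>h\<close>. A level sum of \<open>h\<close> grows like \<open>b ^ (2 * n)\<close>, one of
  the barrier only like \<open>b ^ n\<close>, so the relative error is of order
  \<open>(1 / b) ^ n\<close>.\<close>

lemma \<Phi>_tendsto: "(\<lambda>n. \<Phi> n s * (lam / r) ^ n) \<longlonglongrightarrow> (e s)\<^sup>2 / (1 - \<sigma>)"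
proof -
  define c where "c = e s * (1 / (1 - \<rho> * b) + \<kappa> * (1 / (1 - \<sigma>))) / \<epsilon>"
  have b0: "b > 0" using b_greater by simp
  have inv: "lam / r = inverse (b\<^sup>2)" by (simp add: b_sq)
  have scale: "(b\<^sup>2) ^ n * (lam / r) ^ n = 1" "b ^ n * (lam / r) ^ n = (1 / b) ^ n" for n
    using b0 unfolding inv power_mult_distrib[symmetric] by (simp_all add: power2_eq_square field_simps)
  have upper: "\<Phi> n s \<le> (b\<^sup>2) ^ n * (e s)\<^sup>2 * (1 / (1 - \<sigma>))" for n
    by (rule sums_le[OF _ \<Phi>_sums level_h_sums]) (rule F_level_bounds)
  \<comment> \<open>Level 0 is excluded because \<open>F\<close> is killed there.\<close>
  have lower: "(b\<^sup>2) ^ n * (e s)\<^sup>2 * (1 / (1 - \<sigma>)) - b ^ n * c \<le> \<Phi> n s" if "n > 0" for n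
  proof -
    have diff: "(\<lambda>y. \<rho> ^ y * h (int n, y, s) - \<rho> ^ y * barrier (int n, y, s) / \<epsilon>) sums
        ((b\<^sup>2) ^ n * (e s)\<^sup>2 * (1 / (1 - \<sigma>)) - b ^ n * e s * (1 / (1 - \<rho> * b) + \<kappa> * (1 / (1 - \<sigma>))) / \<epsilon>)"
      by (intro sums_diff sums_divide level_h_sums level_barrier_sums)
    have "(b\<^sup>2) ^ n * (e s)\<^sup>2 * (1 / (1 - \<sigma>)) - b ^ n * e s * (1 / (1 - \<rho> * b) + \<kappa> * (1 / (1 - \<sigma>))) / \<epsilon> \<le> \<Phi> n s"
    proof (rule sums_le[OF _ diff \<Phi>_sums])
      fix y
      have "\<rho> ^ y * (h (int n, y, s) - barrier (int n, y, s) / \<epsilon>) \<le> \<rho> ^ y * F (int n, y, s)"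
        using H_ge[of "(int n, y, s)"] that pos by (intro mult_left_mono) (simp_all add: F_def)
      then show "\<rho> ^ y * h (int n, y, s) - \<rho> ^ y * barrier (int n, y, s) / \<epsilon> \<le> \<rho> ^ y * F (int n, y, s)"
        by (simp add: right_diff_distrib)
    qed
    then show ?thesis by (simp add: c_def mult.assoc)
  qed
  have pw: "(lam / r) ^ n \<ge> 0" for n using pos r_pos by simp
  show ?thesis
  proof (rule real_tendsto_sandwich)
    show "\<forall>\<^sub>F n in sequentially. (e s)\<^sup>2 / (1 - \<sigma>) - c * (1 / b) ^ n \<le> \<Phi> n s * (lam / r) ^ n"
    proof (rule eventually_mono[OF eventually_gt_at_top[of 0]])
      fix n :: nat assume "n > 0"
      have "(e s)\<^sup>2 / (1 - \<sigma>) - c * (1 / b) ^ n =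
          ((b\<^sup>2) ^ n * (lam / r) ^ n) * ((e s)\<^sup>2 * (1 / (1 - \<sigma>))) - c * (b ^ n * (lam / r) ^ n)"
        unfolding scale by simp
      also have "\<dots> = ((b\<^sup>2) ^ n * (e s)\<^sup>2 * (1 / (1 - \<sigma>)) - b ^ n * c) * (lam / r) ^ n"
        by (simp only: left_diff_distrib right_diff_distrib mult_ac)
      also have "\<dots> \<le> \<Phi> n s * (lam / r) ^ n"
        by (rule mult_right_mono[OF lower[OF \<open>n > 0\<close>] pw])
      finally show "(e s)\<^sup>2 / (1 - \<sigma>) - c * (1 / b) ^ n \<le> \<Phi> n s * (lam / r) ^ n" .
    qed
    show "\<forall>\<^sub>F n in sequentially. \<Phi> n s * (lam / r) ^ n \<le> (e s)\<^sup>2 / (1 - \<sigma>)"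
    proof (rule always_eventually, rule allI)
      fix n
      have "\<Phi> n s * (lam / r) ^ n \<le> (b\<^sup>2) ^ n * (e s)\<^sup>2 * (1 / (1 - \<sigma>)) * (lam / r) ^ n"
        by (rule mult_right_mono[OF upper pw])
      also have "\<dots> = ((b\<^sup>2) ^ n * (lam / r) ^ n) * ((e s)\<^sup>2 * (1 / (1 - \<sigma>)))" by (simp only: mult_ac)
      also have "\<dots> = (e s)\<^sup>2 / (1 - \<sigma>)" unfolding scale by simp
      finally show "\<Phi> n s * (lam / r) ^ n \<le> (e s)\<^sup>2 / (1 - \<sigma>)" .
    qed
    have "(\<lambda>n. (e s)\<^sup>2 / (1 - \<sigma>) - c * (1 / b) ^ n) \<longlonglongrightarrow> (e s)\<^sup>2 / (1 - \<sigma>) - c * 0"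
      using b_greater by (intro tendsto_intros LIMSEQ_power_zero) simp
    then show "(\<lambda>n. (e s)\<^sup>2 / (1 - \<sigma>) - c * (1 / b) ^ n) \<longlonglongrightarrow> (e s)\<^sup>2 / (1 - \<sigma>)" by simp
  qed simp
qed

text \<open>\<open>\<rho>\<close> is the ratio of the geometric stationary law of server 2, so the terms for its arrivals and for
  its departures cancel after summation.\<close>

lemma \<Phi>_harmonic:
  "lam * (\<Phi> (n + 2) s - \<Phi> (n + 1) s)
     + (if s = Up then \<mu> * (\<Phi> n Up - \<Phi> (n + 1) Up) + \<alpha> * (\<Phi> (n + 1) Down - \<Phi> (n + 1) Up)
        else \<beta> * (\<Phi> (n + 1) Up - \<Phi> (n + 1) Down)) = 0"
proof -
  define f where "f n s y = \<rho> ^ y * F (int n, y, s)" for n s y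
  have f_sums: "f n s sums \<Phi> n s" for n s unfolding f_def by (rule \<Phi>_sums)
  define N where "N = n + 1"
  \<comment> \<open>The arrival series starts at index 1 and the departure series lacks index 0; the
    two missing terms \<open>f N s 0\<close> cancel in the end.\<close>
  have tail: "(\<lambda>y. f N s (Suc y)) sums (\<Phi> N s - f N s 0)"
    using f_sums[of N s] by (simp add: sums_Suc_iff)
  have arr: "(\<lambda>y. \<mu> * f N s (Suc y)) sums (\<mu> * (\<Phi> N s - f N s 0))"
    by (rule sums_mult[OF tail])
  have dep: "(\<lambda>y. if y \<ge> 1 then lam * f (N + 1) s (y - 1) else 0) sums (lam * \<Phi> (N + 1) s)"
    using sums_Suc_iff[of "\<lambda>y. if y \<ge> 1 then lam * f (N + 1) s (y - 1) else 0" "lam * \<Phi> (N + 1) s"]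
      sums_mult[OF f_sums[of "N + 1" s], of lam] by simp
  have stay: "(\<lambda>y. if y \<ge> 1 then \<mu> * f N s y else 0) sums (\<mu> * (\<Phi> N s - f N s 0))"
    using sums_Suc_iff[of "\<lambda>y. if y \<ge> 1 then \<mu> * f N s y else 0" "\<mu> * (\<Phi> N s - f N s 0)"] arr by simp
  define g where "g s' x = (if s' = Up then \<mu> * (x n Up - x N Up) + \<alpha> * (x N Down - x N Up)
     else \<beta> * (x N Up - x N Down))" for s' :: status and x :: "nat \<Rightarrow> status \<Rightarrow> real"
  have status: "(\<lambda>y. g s (\<lambda>n s. f n s y)) sums g s \<Phi>"
    unfolding g_def by (auto intro!: sums_add sums_diff sums_mult f_sums)
  have "(\<lambda>y. (\<mu> * f N s (Suc y) - lam * f N s y)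
      + ((if y \<ge> 1 then lam * f (N + 1) s (y - 1) else 0) - (if y \<ge> 1 then \<mu> * f N s y else 0))
      + g s (\<lambda>n s. f n s y)) sums
      ((\<mu> * (\<Phi> N s - f N s 0) - lam * \<Phi> N s) + (lam * \<Phi> (N + 1) s - \<mu> * (\<Phi> N s - f N s 0)) + g s \<Phi>)"
    by (intro sums_add sums_diff arr dep stay status sums_mult f_sums)
  moreover have "(\<mu> * f N s (Suc y) - lam * f N s y)
      + ((if y \<ge> 1 then lam * f (N + 1) s (y - 1) else 0) - (if y \<ge> 1 then \<mu> * f N s y else 0))
      + g s (\<lambda>n s. f n s y) = 0" for y
  proof -
    have up: "\<mu> * f N s (Suc y) = \<rho> ^ y * (lam * F (int N, y + 1, s))"
      using pos by (simp add: f_def)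
    have down: "lam * f (N + 1) s (y - 1) = \<rho> ^ y * (\<mu> * F (int N + 1, y - 1, s))" if "y \<ge> 1"
      using pos that by (cases y) (simp_all add: f_def add.commute)
    have prev: "int n = int N - 1" by (simp add: N_def)
    have g: "g s (\<lambda>n s. f n s y) = \<rho> ^ y *
       (if s = Up then \<mu> * (F (int N - 1, y, Up) - F (int N, y, Up)) + \<alpha> * (F (int N, y, Down) - F (int N, y, Up))
        else \<beta> * (F (int N, y, Up) - F (int N, y, Down)))"
      unfolding g_def f_def prev by (simp add: algebra_simps)
    have "(\<mu> * f N s (Suc y) - lam * f N s y)
      + ((if y \<ge> 1 then lam * f (N + 1) s (y - 1) else 0) - (if y \<ge> 1 then \<mu> * f N s y else 0))
      + g s (\<lambda>n s. f n s y) = \<rho> ^ y * free_generator F (int N, y, s)"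
      unfolding up g free_generator_def prod.case using down
      by (simp add: f_def algebra_simps)
    also have "\<dots> = 0" using F_harmonic[of "(int N, y, s)"] by (simp add: N_def)
    finally show ?thesis .
  qed
  ultimately have "(\<lambda>y. 0 :: real) sums
      ((\<mu> * (\<Phi> N s - f N s 0) - lam * \<Phi> N s) + (lam * \<Phi> (N + 1) s - \<mu> * (\<Phi> N s - f N s 0)) + g s \<Phi>)"
    by simp
  then have "(\<mu> * (\<Phi> N s - f N s 0) - lam * \<Phi> N s) + (lam * \<Phi> (N + 1) s - \<mu> * (\<Phi> N s - f N s 0)) + g s \<Phi> = 0"
    using sums_unique2 sums_zero by blast
  then show ?thesis unfolding g_def N_def by (cases s) (simp_all add: right_diff_distrib)
qed

section \<open>The flux between levels and the value of \<open>eta2\<close>\<close>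

text \<open>The net stationary flow of server 1 across the cut between \<open>n\<close> and
  \<open>n + 1\<close>, each jump weighted by \<open>\<Phi>\<close> at its target.\<close>

definition flux :: "nat \<Rightarrow> real" where
  "flux n = lam * (up_weight n * \<Phi> (n + 1) Up + down_weight n * \<Phi> (n + 1) Down) - \<mu> * up_weight (n + 1) * \<Phi> n Up"

text \<open>Summation by parts: the difference combines the harmonic equations of
  \<open>\<Phi>\<close>, weighted by the stationary law, with the balance equations, weighted by
  \<open>\<Phi>\<close>. The bracket at \<open>\<Phi> (n + 1) Up\<close> is the balance of an Up
  state, composed of two cut equations and one Down balance.\<close>

lemma flux_Suc: "flux (Suc n) = flux n"
proof -
  have "flux (Suc n) - flux n =
      up_weight (Suc n) * (lam * (\<Phi> (n + 2) Up - \<Phi> (n + 1) Up) + (\<mu> * (\<Phi> n Up - \<Phi> (n + 1) Up) + \<alpha> * (\<Phi> (n + 1) Down - \<Phi> (n + 1) Up)))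
      + down_weight (Suc n) * (lam * (\<Phi> (n + 2) Down - \<Phi> (n + 1) Down) + \<beta> * (\<Phi> (n + 1) Up - \<Phi> (n + 1) Down))
      + \<Phi> (n + 1) Up * ((lam * (up_weight (Suc n) + down_weight (Suc n)) - \<mu> * up_weight (Suc (Suc n)))
          + (\<mu> * up_weight (Suc n) - lam * (up_weight n + down_weight n))
          + (\<alpha> * up_weight (Suc n) + lam * down_weight n - (lam + \<beta>) * down_weight (Suc n)))
      + \<Phi> (n + 1) Down * ((lam + \<beta>) * down_weight (Suc n) - (\<alpha> * up_weight (Suc n) + lam * down_weight n))"
    unfolding flux_def by (simp add: algebra_simps)
  also have "\<dots> = 0"
    using \<Phi>_harmonic[of n Up] \<Phi>_harmonic[of n Down] up_weight_Suc down_weight_Suc by simp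
  finally show ?thesis by simp
qed

lemma weight_tendsto:
  "(\<lambda>n. up_weight n / (lam / r) ^ n) \<longlonglongrightarrow> lead"
  "(\<lambda>n. down_weight n / (lam / r) ^ n) \<longlonglongrightarrow> lead * (\<alpha> / t)"
proof -
  have "\<bar>r / r'\<bar> < 1" using r_r' r_pos by simp
  then have lim: "(\<lambda>n. (r / r') ^ n) \<longlonglongrightarrow> 0" by (intro LIMSEQ_power_zero) simp
  have form: "(c * (lam / r) ^ n + d * (lam / r') ^ n) / (lam / r) ^ n = c + d * (r / r') ^ n" for c d n
  proof -
    have "r / r' = (lam / r') / (lam / r)" using pos r_pos by simp
    then have "(r / r') ^ n = (lam / r') ^ n / (lam / r) ^ n" by (simp only: power_divide)
    moreover have "(lam / r) ^ n \<noteq> 0" using pos r_pos by simp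
    ultimately show ?thesis by (simp only: add_divide_distrib nonzero_mult_div_cancel_right times_divide_eq_right not_False_eq_True)
  qed
  have "(\<lambda>n. c + d * (r / r') ^ n) \<longlonglongrightarrow> c + d * 0" for c d
    by (intro tendsto_intros lim)
  \<comment> \<open>The Down to Up ratio of the dominant solution, which is also the ratio of the
    two constants \<open>C2\<close>.\<close>
  moreover have "\<mu> / r - 1 = \<alpha> / t"
    using t_r r_pos t_pos by (simp add: field_simps)
  ultimately show "(\<lambda>n. up_weight n / (lam / r) ^ n) \<longlonglongrightarrow> lead"
    "(\<lambda>n. down_weight n / (lam / r) ^ n) \<longlonglongrightarrow> lead * (\<alpha> / t)"
    unfolding up_weight_def down_weight_def form by simp_all
qed

text \<open>The constant flux is read off at infinity, where it is the limiting mass of a level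
  times the drift of the twisted process.\<close>

lemma flux_0:
  "flux 0 = lead / t * G_const lam \<mu> \<alpha> \<beta> * (C * d2_tilde C lam \<mu> \<alpha> \<beta>) / B_const lam \<mu> \<alpha> \<beta>"
proof (rule LIMSEQ_unique)
  have "flux n = flux 0" for n by (induction n) (simp_all add: flux_Suc)
  then show "flux \<longlonglongrightarrow> flux 0" by (simp add: fun_eq_iff tendsto_eventually)
  define \<gamma> where "\<gamma> = lam / r"
  have \<gamma>: "\<gamma> > 0" using pos r_pos by (simp add: \<gamma>_def)
  define G where "G = t + \<alpha> * \<beta> / t"
  have G: "G > 0" using pos t_pos by (simp add: G_def add_pos_pos)
  have B: "1 - \<sigma> > 0" using \<sigma>_bounds by simp
  \<comment> \<open>Rescaling by powers of \<open>\<gamma>\<close> makes every factor converge; the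
    level difference of 1 turns the rates \<open>lam\<close> and \<open>\<mu>\<close> into
    \<open>r = lam / \<gamma>\<close> and \<open>\<mu> * \<gamma>\<close>.\<close>
  have eq: "flux n = r * (up_weight n / \<gamma> ^ n * (\<Phi> (Suc n) Up * \<gamma> ^ Suc n)
      + down_weight n / \<gamma> ^ n * (\<Phi> (Suc n) Down * \<gamma> ^ Suc n))
      - \<mu> * \<gamma> * (up_weight (Suc n) / \<gamma> ^ Suc n * (\<Phi> n Up * \<gamma> ^ n))" for n
  proof -
    have "r * (up_weight n / \<gamma> ^ n * (\<Phi> (Suc n) Up * \<gamma> ^ Suc n)
      + down_weight n / \<gamma> ^ n * (\<Phi> (Suc n) Down * \<gamma> ^ Suc n)) =
      lam * (up_weight n * \<Phi> (Suc n) Up + down_weight n * \<Phi> (Suc n) Down)"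
    proof -
      have "r * (u / \<gamma> ^ n * (p * \<gamma> ^ Suc n) + w / \<gamma> ^ n * (q * \<gamma> ^ Suc n)) = (r * \<gamma>) * (u * p + w * q)" for u p w q
        using \<gamma> by (simp add: field_simps)
      moreover have "r * \<gamma> = lam" using r_pos by (simp add: \<gamma>_def)
      ultimately show ?thesis by simp
    qed
    moreover have "\<mu> * \<gamma> * (up_weight (Suc n) / \<gamma> ^ Suc n * (\<Phi> n Up * \<gamma> ^ n)) = \<mu> * up_weight (Suc n) * \<Phi> n Up"
      using \<gamma> by (simp add: field_simps)
    ultimately show ?thesis by (simp only: flux_def Suc_eq_plus1)
  qed
  have "flux \<longlonglongrightarrow> r * (lead * ((e Up)\<^sup>2 / (1 - \<sigma>)) + lead * (\<alpha> / t) * ((e Down)\<^sup>2 / (1 - \<sigma>)))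
      - \<mu> * \<gamma> * (lead * ((e Up)\<^sup>2 / (1 - \<sigma>)))"
    unfolding eq
    by (intro tendsto_intros weight_tendsto[folded \<gamma>_def] \<Phi>_tendsto[folded \<gamma>_def]
        LIMSEQ_Suc[OF \<Phi>_tendsto[folded \<gamma>_def]] LIMSEQ_Suc[OF weight_tendsto(1)[folded \<gamma>_def]])
  also have "r * (lead * ((e Up)\<^sup>2 / (1 - \<sigma>)) + lead * (\<alpha> / t) * ((e Down)\<^sup>2 / (1 - \<sigma>)))
      - \<mu> * \<gamma> * (lead * ((e Up)\<^sup>2 / (1 - \<sigma>))) =
      lead / t * (r * G - \<mu> * \<gamma> * t) / (1 - \<sigma>)"
  proof -
    have "(e Up)\<^sup>2 = 1" "(e Down)\<^sup>2 = \<beta> / t" using pos t_pos by (simp_all add: e_def)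
    moreover have "r * (lead * (1 / (1 - \<sigma>)) + lead * (\<alpha> / t) * (\<beta> / t / (1 - \<sigma>))) - \<mu> * \<gamma> * (lead * (1 / (1 - \<sigma>)))
       = lead * (r * (1 + \<alpha> / t * (\<beta> / t)) - \<mu> * \<gamma>) / (1 - \<sigma>)"
      using B by (simp add: diff_divide_distrib add_divide_distrib algebra_simps)
    moreover have "r * (1 + \<alpha> / t * (\<beta> / t)) - \<mu> * \<gamma> = (r * G - \<mu> * \<gamma> * t) / t"
      using t_pos by (simp add: G_def field_simps)
    ultimately show ?thesis by simp
  qed
  also have "r * G - \<mu> * \<gamma> * t = G * (C * d2_tilde C lam \<mu> \<alpha> \<beta>)"
    unfolding d2_tilde_eq G_def[symmetric] using C_pos G r_pos by (simp add: \<gamma>_def field_simps)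
  finally show "flux \<longlonglongrightarrow> lead / t * G_const lam \<mu> \<alpha> \<beta> * (C * d2_tilde C lam \<mu> \<alpha> \<beta>) / B_const lam \<mu> \<alpha> \<beta>"
    unfolding G_const_eq B_const_eq G_def[symmetric] by (simp add: mult.assoc)
qed

text \<open>By \<open>h_H_boundary\<close> each term is carried by a departure from server 2, and
  \<open>\<rho> ^ (y + 1) * \<mu> = lam * \<rho> ^ y\<close> converts these departures into arrivals
  at server 1. The result is the upward part of \<open>flux 0\<close>; the downward part vanishes
  with \<open>\<Phi> 0\<close>.\<close>

lemma eta2_eq:
  assumes "N \<ge> 0" and \<pi>: "\<And>z. pmf \<pi> z = N * weight z"
  shows "eta2 C lam \<mu> \<alpha> \<beta> \<pi> = N * flux 0 / C"
proof -
  define mass where "mass y = (\<Sum>s\<in>{Up, Down}. pmf \<pi> (0, y, s) * h (0, y, s) * H (0, y, s))" for y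
  have shifted: "mass (Suc y) = N * lam / C * (up_weight 0 * (\<rho> ^ y * F (1, y, Up)) + down_weight 0 * (\<rho> ^ y * F (1, y, Down)))" for y
  proof -
    have "mass (Suc y) = (\<Sum>s\<in>{Up, Down}. pmf \<pi> (0, Suc y, s) * (h (0, Suc y, s) * H (0, Suc y, s)))"
      by (simp only: mass_def mult.assoc)
    also have "\<dots> = N * \<rho> ^ Suc y * \<mu> / C * (up_weight 0 * F (1, y, Up) + down_weight 0 * F (1, y, Down))"
      unfolding \<pi> h_H_boundary by (simp add: weight_def algebra_simps del: power_Suc)
    also have "N * \<rho> ^ Suc y * \<mu> / C = N * lam / C * \<rho> ^ y" using pos by simp
    finally show ?thesis by (simp add: algebra_simps)
  qed
  have "mass 0 = (\<Sum>s\<in>{Up, Down}. pmf \<pi> (0, 0, s) * (h (0, 0, s) * H (0, 0, s)))"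
    by (simp only: mass_def mult.assoc)
  then have zero: "mass 0 = 0" unfolding h_H_boundary by simp
  have "(\<lambda>y. mass (Suc y)) sums (N * lam / C * (up_weight 0 * \<Phi> 1 Up + down_weight 0 * \<Phi> 1 Down))"
    unfolding shifted using \<Phi>_sums[of 1 Up] \<Phi>_sums[of 1 Down] by (intro sums_mult sums_add) simp_all
  then have "mass sums (N * flux 0 / C)"
    using sums_Suc_iff[of "mass"] zero by (simp add: flux_def \<Phi>_0 mult.assoc)
  moreover have "mass y \<ge> 0" for y
    using h_pos H_bounds(1) by (auto simp: mass_def less_imp_le simp del: twist_h.simps intro!: add_nonneg_nonneg mult_nonneg_nonneg)
  ultimately have "(mass has_sum (N * flux 0 / C)) UNIV" by (rule sums_nonneg_imp_has_sum)
  then show ?thesis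
    unfolding eta2_def by (simp only: infsumI mass_def[symmetric])
qed

lemma C2_eq:
  assumes "N \<ge> 0" and "\<And>z. pmf \<pi> z = N * weight z"
  shows "C2 C lam \<mu> \<alpha> \<beta> \<pi> Up = N * lead" "C2 C lam \<mu> \<alpha> \<beta> \<pi> Down = N * (lead * (\<alpha> / t))"
proof -
  define G d B where "G = G_const lam \<mu> \<alpha> \<beta>" and "d = d2_tilde C lam \<mu> \<alpha> \<beta>" and "B = B_const lam \<mu> \<alpha> \<beta>"
  have nz: "G \<noteq> 0" "d \<noteq> 0" "B \<noteq> 0" "C \<noteq> 0" "t \<noteq> 0"
    using d2_tilde_pos C_pos t_pos pos r_less
    by (auto simp: G_def d_def B_def G_const_eq B_const_eq add_pos_pos less_imp_neq[symmetric] field_simps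
        intro!: less_imp_neq[symmetric])
  have eta: "eta2 C lam \<mu> \<alpha> \<beta> \<pi> = N * (lead / t * G * (C * d) / B) / C"
    unfolding eta2_eq[OF assms] flux_0 G_def d_def B_def ..
  show "C2 C lam \<mu> \<alpha> \<beta> \<pi> Up = N * lead" "C2 C lam \<mu> \<alpha> \<beta> \<pi> Down = N * (lead * (\<alpha> / t))"
    unfolding C2.simps t_def[symmetric] eta G_def[symmetric] d_def[symmetric] B_def[symmetric]
    using nz by (simp_all add: field_simps)
qed

end

theorem proposition2p5:
  fixes lam \<mu> \<alpha> \<beta> C :: real and \<pi> :: "state pmf"
  assumes "lam > 0" "\<mu> > 0" "\<alpha> > 0" "\<beta> > 0"
    and "lam < \<beta> / (\<alpha> + \<beta>) * \<mu>"
    and "C \<ge> lam + 2 * \<mu> + \<alpha> + \<beta>"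
    and "stationary_distribution (rate lam \<mu> \<alpha> \<beta>) \<pi>"
  shows "(\<forall>y. (\<lambda>k. pmf \<pi> (k, y, Up)) \<sim>[at_top]
                (\<lambda>k. C2 C lam \<mu> \<alpha> \<beta> \<pi> Up * (lam / \<mu>) ^ y * gamma1 lam \<mu> \<alpha> \<beta> ^ k)
            \<and> (\<lambda>k. pmf \<pi> (k, y, Down)) \<sim>[at_top]
                (\<lambda>k. C2 C lam \<mu> \<alpha> \<beta> \<pi> Down * (lam / \<mu>) ^ y * gamma1 lam \<mu> \<alpha> \<beta> ^ k))
         \<and> C2 C lam \<mu> \<alpha> \<beta> \<pi> Up \<noteq> 0 \<and> C2 C lam \<mu> \<alpha> \<beta> \<pi> Down \<noteq> 0"
proof -
  interpret tandem_queue lam \<mu> \<alpha> \<beta> C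
    by unfold_locales (use assms in simp_all)
  obtain N where N: "N > 0" "\<And>z. pmf \<pi> z = N * weight z"
    using product_form[OF assms(7)] by blast
  note C2 = C2_eq[OF less_imp_le[OF N(1)] N(2)]
  have nz: "C2 C lam \<mu> \<alpha> \<beta> \<pi> Up \<noteq> 0" "C2 C lam \<mu> \<alpha> \<beta> \<pi> Down \<noteq> 0"
    unfolding C2 using N(1) lead_pos pos t_pos by simp_all
  \<comment> \<open>Covers both statuses: \<open>w\<close> is the factor depending on
    \<open>k\<close>, and \<open>a\<close> is its limit after division by the power of
    \<open>gamma1\<close>.\<close>
  have asymp: "(\<lambda>k. pmf \<pi> (k, y, s)) \<sim>[at_top] (\<lambda>k. c * (lam / \<mu>) ^ y * gamma1 lam \<mu> \<alpha> \<beta> ^ k)"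
    if w: "\<And>k. weight (k, y, s) = (lam / \<mu>) ^ y * w k" and lim: "(\<lambda>k. w k / (lam / r) ^ k) \<longlonglongrightarrow> a"
      and c: "c = N * a" "c \<noteq> 0" for y s w a c
  proof (rule asymp_equivI'_const)
    have "(\<lambda>k. N * (lam / \<mu>) ^ y * (w k / (lam / r) ^ k)) \<longlonglongrightarrow> N * (lam / \<mu>) ^ y * a"
      by (intro tendsto_intros lim)
    then show "(\<lambda>k. pmf \<pi> (k, y, s) / gamma1 lam \<mu> \<alpha> \<beta> ^ k) \<longlonglongrightarrow> c * (lam / \<mu>) ^ y"
      by (simp add: N(2) w c gamma1_eq mult_ac)
    show "c * (lam / \<mu>) ^ y \<noteq> 0" using c pos by simp
  qed
  have "(\<lambda>k. pmf \<pi> (k, y, Up)) \<sim>[at_top] (\<lambda>k. C2 C lam \<mu> \<alpha> \<beta> \<pi> Up * (lam / \<mu>) ^ y * gamma1 lam \<mu> \<alpha> \<beta> ^ k)"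
    "(\<lambda>k. pmf \<pi> (k, y, Down)) \<sim>[at_top] (\<lambda>k. C2 C lam \<mu> \<alpha> \<beta> \<pi> Down * (lam / \<mu>) ^ y * gamma1 lam \<mu> \<alpha> \<beta> ^ k)" for y
    by (rule asymp[OF _ weight_tendsto(1) C2(1) nz(1)], simp add: weight_def)
      (rule asymp[OF _ weight_tendsto(2) C2(2) nz(2)], simp add: weight_def)
  with nz show ?thesis by blast
qed

end
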